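(* Let $(\mathcal{A}_i,\varphi_i)_{i\in I}$ be a family of noncommutative probability spaces and let $(\mathcal{A}_{\rm rep},\Phi)$ be the associated replica space. If $a_k\in\mathcal{A}_{i_k}$ for $k=1,\dots,n$ and $j_1,\dots,j_n\in\mathbb{N}$, then $$\Phi(a_1(j_1)\cdots a_n(j_n))=0$$ whenever $w:=j_1\cdots j_n\notin\mathcal{M}_n(i_1,\dots,i_n)$, where $$\mathcal{M}_n(i_1,\dots,i_n)=\{w=j_1\cdots j_n\in\mathcal{M}_n:\ j_k=j_{k+1}\text{ if }i_k=i_{k+1},\ k=1,\dots,n-1\}.$$ In particular, if $i_1\neq\cdots\neq i_n$, then $\Phi(a_1(j_1)\cdots a_n(j_n))=0$ whenever $w=j_1\cdots j_n\notin\mathcal{M}_n$.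
   Context: **Probability spaces and notation.** $\mathbb{N}=\{1,2,\dots\}$. A noncommutative probability space $(\mathcal{A},\varphi)$ is a unital complex algebra with a linear functional $\varphi$ such that $\varphi(1)=1$. The unit of $\mathcal{A}_i$ is $1_i$. The notation $i_1\neq\cdots\neq i_n$ means that $i_k\neq i_{k+1}$ for all $k$. **Orthogonal replicas and the replica space.** For each $i\in I$ let $p_i$ be an abstract idempotent ($p_i^2=p_i$) and let $\widetilde{\mathcal{A}}_i=\mathcal{A}_i\star\mathbb{C}[p_i]$ (free product with identified units, where $\mathbb{C}[p_i]$ is the unital algebra generated by $p_i$), with the linear functional $\widetilde\varphi_i$ determined by $\widetilde\varphi_i(p_i)=1$ and $\widetilde\varphi_i(p_i^{\gamma}a_1p_ia_2p_i\cdots p_ia_mp_i^{\delta})=\varphi_i(a_1)\cdots\varphi_i(a_m)$ for $\gamma,\delta\in\{0,1\}$, $a_1,\dots,a_m\in\mathcal{A}_i$. Let $\mathcal{A}_\otimes=\bigotimes_{i\in I}\widetilde{\mathcal{A}}_i^{\otimes\infty}$ be the infinite tensor product spanned by simple tensors $\bigotimes_{i\in I}\bigotimes_{k=1}^\infty x_{i,k}$ with $x_{i,k}\in\widetilde{\mathcal{A}}_i$ and $x_{i,k}\notin\{1_i,p_i\}$ for only finitely many sites $(i,k)$ (multilinear in the entries, multiplied sitewise), and let $\Phi_\otimes$ be the linear functional with $\Phi_\otimes(\bigotimes x_{i,k})=\prod_{i,k}\widetilde\varphi_i(x_{i,k})$. For $i\in I$ and $j\in\mathbb{N}$ let $P_i(j)$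 be the simple tensor with $1_i$ at all sites $(i,m)$ and, for each $k\neq i$, with $1_k$ at sites $(k,m)$, $m\le j-1$, and $p_k$ at sites $(k,m)$, $m\geq j$; put $P_i(0)=0$ and $p_i(j)=P_i(j)-P_i(j-1)$. For $a\in\mathcal{A}_i$ let $\iota_j(a)$ be the simple tensor with $a$ at site $(i,j)$ and units elsewhere. The orthogonal replica of $a\in\mathcal{A}_i$ of label $i$ and color $j$ is $a(j)=\iota_j(a)\,p_i(j)$. $\mathcal{A}_{\rm rep}$ is the unital subalgebra of $\mathcal{A}_\otimes$ generated by all replicas, and $\Phi$ is the restriction of $\Phi_\otimes$ to $\mathcal{A}_{\rm rep}$. **Motzkin words.** $\mathcal{M}_n$ is the set of reduced Motzkin words of length $n$, i.e. words $w=j_1\cdots j_n$ in letters from $\mathbb{N}$ with $j_1=j_n=1$ and $|j_k-j_{k-1}|\in\{0,1\}$ for $1<k\le n$. *)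

theory Defs
  imports
    Complex_Main
    "HOL-Library.FuncSet"
    "HOL-Library.Poly_Mapping"
    "HOL-Algebra.Module"
    "HOL-Algebra.QuotRing"
    "HOL-Algebra.Subrings"
begin

section \<open>Complex algebras and noncommutative probability spaces\<close>

definition complex_ring :: "complex ring" where
  "complex_ring = \<lparr>carrier = UNIV, monoid.mult = (*), one = 1, zero = 0, add = (+)\<rparr>"

text \<open>The locale \<open>algebra\<close> of the library is restricted to commutative algebras.\<close>

locale complex_algebra = module complex_ring A + ring A
  for A :: "(complex, 'a) module" (structure) +
  assumes smult_mult_left:
      "\<lbrakk>x \<in> carrier A; y \<in> carrier A\<rbrakk> \<Longrightarrow> (c \<odot> x) \<otimes> y = c \<odot> (x \<otimes> y)"
    and smult_mult_right:
      "\<lbrakk>x \<in> carrier A; y \<in> carrier A\<rbrakk> \<Longrightarrow> x \<otimes> (c \<odot> y) = c \<odot> (x \<otimes> y)"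

definition linear_functional :: "(complex, 'a) module \<Rightarrow> ('a \<Rightarrow> complex) \<Rightarrow> bool" where
  "linear_functional A f \<longleftrightarrow>
     (\<forall>x\<in>carrier A. \<forall>y\<in>carrier A. f (x \<oplus>\<^bsub>A\<^esub> y) = f x + f y) \<and>
     (\<forall>c. \<forall>x\<in>carrier A. f (c \<odot>\<^bsub>A\<^esub> x) = c * f x)"

locale nc_probability_space = complex_algebra A
  for A :: "(complex, 'a) module" (structure) and \<phi> +
  assumes functional_linear: "linear_functional A \<phi>"
    and functional_one: "\<phi> \<one> = 1"

section \<open>Monoid algebras, quotients and free products\<close>

definition monoid_algebra :: "'m monoid \<Rightarrow> (complex, 'm \<Rightarrow>\<^sub>0 complex) module" where
  "monoid_algebra M =
     \<lparr>carrier = {f. Poly_Mapping.keys f \<subseteq> carrier M},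
      monoid.mult = (\<lambda>f g. \<Sum>x\<in>Poly_Mapping.keys f. \<Sum>y\<in>Poly_Mapping.keys g.
        Poly_Mapping.single (x \<otimes>\<^bsub>M\<^esub> y) (Poly_Mapping.lookup f x * Poly_Mapping.lookup g y)),
      one = Poly_Mapping.single \<one>\<^bsub>M\<^esub> 1,
      zero = 0,
      add = (+),
      smult = (\<lambda>c. Poly_Mapping.map (\<lambda>z. c * z))\<rparr>"

definition quotient_algebra ::
    "(complex, 'a) module \<Rightarrow> 'a set \<Rightarrow> (complex, 'a set) module" where
  "quotient_algebra A J =
     ring.extend (A Quot J) (module.fields (\<lambda>c X. \<Union>x\<in>X. J +>\<^bsub>A\<^esub> (c \<odot>\<^bsub>A\<^esub> x)))"

definition free_monoid :: "'g set \<Rightarrow> 'g list monoid" where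
  "free_monoid S = \<lparr>carrier = lists S, monoid.mult = (@), one = []\<rparr>"

abbreviation letter :: "'g \<Rightarrow> 'g list \<Rightarrow>\<^sub>0 complex" where
  "letter g \<equiv> Poly_Mapping.single [g] 1"

text \<open>The relations in the free algebra \<open>F\<close> that make \<open>x \<mapsto> letter (l x)\<close> a homomorphism of
  unital algebras on \<open>A\<close>.\<close>

definition hom_relations ::
    "(complex, 'g list \<Rightarrow>\<^sub>0 complex) module \<Rightarrow> (complex, 'a) module \<Rightarrow> ('a \<Rightarrow> 'g)
      \<Rightarrow> ('g list \<Rightarrow>\<^sub>0 complex) set" where
  "hom_relations F A l =
     {letter (l (x \<oplus>\<^bsub>A\<^esub> y)) \<ominus>\<^bsub>F\<^esub> (letter (l x) \<oplus>\<^bsub>F\<^esub> letter (l y)) | x y.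
        x \<in> carrier A \<and> y \<in> carrier A} \<union>
     {letter (l (c \<odot>\<^bsub>A\<^esub> x)) \<ominus>\<^bsub>F\<^esub> c \<odot>\<^bsub>F\<^esub> letter (l x) | c x. x \<in> carrier A} \<union>
     {letter (l (x \<otimes>\<^bsub>A\<^esub> y)) \<ominus>\<^bsub>F\<^esub> letter (l x) \<otimes>\<^bsub>F\<^esub> letter (l y) | x y.
        x \<in> carrier A \<and> y \<in> carrier A} \<union>
     {letter (l \<one>\<^bsub>A\<^esub>) \<ominus>\<^bsub>F\<^esub> \<one>\<^bsub>F\<^esub>}"

definition free_product_cover ::
    "(complex, 'a) module \<Rightarrow> (complex, 'b) module
      \<Rightarrow> (complex, ('a + 'b) list \<Rightarrow>\<^sub>0 complex) module" where
  "free_product_cover A B = monoid_algebra (free_monoid (carrier A <+> carrier B))"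

definition free_product_ideal ::
    "(complex, 'a) module \<Rightarrow> (complex, 'b) module \<Rightarrow> (('a + 'b) list \<Rightarrow>\<^sub>0 complex) set" where
  "free_product_ideal A B = (let F = free_product_cover A B in
     genideal F (hom_relations F A Inl \<union> hom_relations F B Inr))"

text \<open>Free product with identified units: both units are identified with the unit of the free
  algebra.\<close>

definition free_product ::
    "(complex, 'a) module \<Rightarrow> (complex, 'b) module
      \<Rightarrow> (complex, (('a + 'b) list \<Rightarrow>\<^sub>0 complex) set) module" where
  "free_product A B = quotient_algebra (free_product_cover A B) (free_product_ideal A B)"

definition free_product_in ::
    "(complex, 'a) module \<Rightarrow> (complex, 'b) module \<Rightarrow> 'a + 'b
      \<Rightarrow> (('a + 'b) list \<Rightarrow>\<^sub>0 complex) set" where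
  "free_product_in A B g =
     free_product_ideal A B +>\<^bsub>free_product_cover A B\<^esub> letter g"

section \<open>Adjoining an idempotent\<close>

text \<open>The unital algebra generated by an abstract idempotent \<open>p\<close>; the pair \<open>(\<alpha>, \<beta>)\<close> stands for
  \<open>\<alpha> 1 + \<beta> p\<close>.\<close>

definition idem_algebra :: "(complex, complex \<times> complex) module" where
  "idem_algebra =
     \<lparr>carrier = UNIV,
      monoid.mult = (\<lambda>(\<alpha>, \<beta>) (\<alpha>', \<beta>'). (\<alpha> * \<alpha>', \<alpha> * \<beta>' + \<beta> * \<alpha>' + \<beta> * \<beta>')),
      one = (1, 0),
      zero = (0, 0),
      add = (\<lambda>(\<alpha>, \<beta>) (\<alpha>', \<beta>'). (\<alpha> + \<alpha>', \<beta> + \<beta>')),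
      smult = (\<lambda>c (\<alpha>, \<beta>). (c * \<alpha>, c * \<beta>))\<rparr>"

type_synonym 'a tilde = "(('a + complex \<times> complex) list \<Rightarrow>\<^sub>0 complex) set"

definition tilde :: "(complex, 'a) module \<Rightarrow> (complex, 'a tilde) module" where
  "tilde A = free_product A idem_algebra"

definition tilde_in :: "(complex, 'a) module \<Rightarrow> 'a \<Rightarrow> 'a tilde" where
  "tilde_in A a = free_product_in A idem_algebra (Inl a)"

definition tilde_p :: "(complex, 'a) module \<Rightarrow> 'a tilde" where
  "tilde_p A = free_product_in A idem_algebra (Inr (0, 1))"

text \<open>The word \<open>a\<^sub>1 p a\<^sub>2 p \<dots> p a\<^sub>m\<close>, for \<open>m \<ge> 1\<close>.\<close>

fun alternating_word :: "(complex, 'a) module \<Rightarrow> 'a list \<Rightarrow> 'a tilde" where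
  "alternating_word A [] = \<one>\<^bsub>tilde A\<^esub>"
| "alternating_word A [a] = tilde_in A a"
| "alternating_word A (a # b # as) =
     tilde_in A a \<otimes>\<^bsub>tilde A\<^esub> tilde_p A \<otimes>\<^bsub>tilde A\<^esub> alternating_word A (b # as)"

definition is_tilde_functional ::
    "(complex, 'a) module \<Rightarrow> ('a \<Rightarrow> complex) \<Rightarrow> ('a tilde \<Rightarrow> complex) \<Rightarrow> bool" where
  "is_tilde_functional A \<phi> f \<longleftrightarrow>
     linear_functional (tilde A) f \<and>
     f (tilde_p A) = 1 \<and>
     (\<forall>\<gamma>\<in>{0, 1::nat}. \<forall>\<delta>\<in>{0, 1::nat}. \<forall>as. as \<noteq> [] \<and> set as \<subseteq> carrier A \<longrightarrow>
        f ((tilde_p A [^]\<^bsub>tilde A\<^esub> \<gamma>) \<otimes>\<^bsub>tilde A\<^esub> alternating_word A as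
             \<otimes>\<^bsub>tilde A\<^esub> (tilde_p A [^]\<^bsub>tilde A\<^esub> \<delta>))
          = prod_list (map \<phi> as))"

text \<open>These conditions determine the values on \<open>carrier (tilde A)\<close>; values elsewhere are
  irrelevant.\<close>

definition tilde_functional ::
    "(complex, 'a) module \<Rightarrow> ('a \<Rightarrow> complex) \<Rightarrow> 'a tilde \<Rightarrow> complex" where
  "tilde_functional A \<phi> = (SOME f. is_tilde_functional A \<phi> f)"

section \<open>The infinite tensor product\<close>

text \<open>Sites are pairs \<open>(i, k)\<close> with \<open>i \<in> I\<close> and \<open>k \<ge> 1\<close>. A simple tensor is given by its family of
  entries, which is \<open>undefined\<close> outside the sites.\<close>

definition sites :: "'i set \<Rightarrow> ('i \<times> nat) set" where
  "sites I = I \<times> {1..}"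

definition entry_families ::
    "'i set \<Rightarrow> ('i \<Rightarrow> (complex, 'a) module) \<Rightarrow> ('i \<times> nat \<Rightarrow> 'a tilde) set" where
  "entry_families I A =
     {x \<in> (\<Pi>\<^sub>E s\<in>sites I. carrier (tilde (A (fst s)))).
        finite {s \<in> sites I. x s \<notin> {\<one>\<^bsub>tilde (A (fst s))\<^esub>, tilde_p (A (fst s))}}}"

definition entry_monoid ::
    "'i set \<Rightarrow> ('i \<Rightarrow> (complex, 'a) module) \<Rightarrow> ('i \<times> nat \<Rightarrow> 'a tilde) monoid" where
  "entry_monoid I A =
     \<lparr>carrier = entry_families I A,
      monoid.mult = (\<lambda>x y. \<lambda>s\<in>sites I. x s \<otimes>\<^bsub>tilde (A (fst s))\<^esub> y s),
      one = (\<lambda>s\<in>sites I. \<one>\<^bsub>tilde (A (fst s))\<^esub>)\<rparr>"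

definition tensor_cover ::
    "'i set \<Rightarrow> ('i \<Rightarrow> (complex, 'a) module)
      \<Rightarrow> (complex, ('i \<times> nat \<Rightarrow> 'a tilde) \<Rightarrow>\<^sub>0 complex) module" where
  "tensor_cover I A = monoid_algebra (entry_monoid I A)"

definition multilinear_relations ::
    "'i set \<Rightarrow> ('i \<Rightarrow> (complex, 'a) module)
      \<Rightarrow> (('i \<times> nat \<Rightarrow> 'a tilde) \<Rightarrow>\<^sub>0 complex) set" where
  "multilinear_relations I A = (let F = tensor_cover I A in
     {Poly_Mapping.single (x(s := u \<oplus>\<^bsub>tilde (A (fst s))\<^esub> v)) 1
        \<ominus>\<^bsub>F\<^esub> (Poly_Mapping.single (x(s := u)) 1 \<oplus>\<^bsub>F\<^esub> Poly_Mapping.single (x(s := v)) 1) | x s u v.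
        x \<in> entry_families I A \<and> s \<in> sites I \<and>
        u \<in> carrier (tilde (A (fst s))) \<and> v \<in> carrier (tilde (A (fst s)))} \<union>
     {Poly_Mapping.single (x(s := c \<odot>\<^bsub>tilde (A (fst s))\<^esub> u)) 1
        \<ominus>\<^bsub>F\<^esub> c \<odot>\<^bsub>F\<^esub> Poly_Mapping.single (x(s := u)) 1 | x s c u.
        x \<in> entry_families I A \<and> s \<in> sites I \<and> u \<in> carrier (tilde (A (fst s)))})"

text \<open>Sitewise multiplication by a family maps multilinear relations to multilinear relations, so
  the ideal they generate is just their linear span.\<close>

definition tensor_ideal ::
    "'i set \<Rightarrow> ('i \<Rightarrow> (complex, 'a) module)
      \<Rightarrow> (('i \<times> nat \<Rightarrow> 'a tilde) \<Rightarrow>\<^sub>0 complex) set" where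
  "tensor_ideal I A = genideal (tensor_cover I A) (multilinear_relations I A)"

type_synonym ('i, 'a) tensor = "(('i \<times> nat \<Rightarrow> 'a tilde) \<Rightarrow>\<^sub>0 complex) set"

definition tensor_algebra ::
    "'i set \<Rightarrow> ('i \<Rightarrow> (complex, 'a) module) \<Rightarrow> (complex, ('i, 'a) tensor) module" where
  "tensor_algebra I A = quotient_algebra (tensor_cover I A) (tensor_ideal I A)"

definition simple_tensor ::
    "'i set \<Rightarrow> ('i \<Rightarrow> (complex, 'a) module) \<Rightarrow> ('i \<times> nat \<Rightarrow> 'a tilde) \<Rightarrow> ('i, 'a) tensor" where
  "simple_tensor I A x = tensor_ideal I A +>\<^bsub>tensor_cover I A\<^esub> Poly_Mapping.single x 1"

text \<open>All but finitely many factors of the infinite product equal 1; they are omitted.\<close>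

definition is_tensor_functional ::
    "'i set \<Rightarrow> ('i \<Rightarrow> (complex, 'a) module) \<Rightarrow> ('i \<Rightarrow> 'a \<Rightarrow> complex)
      \<Rightarrow> (('i, 'a) tensor \<Rightarrow> complex) \<Rightarrow> bool" where
  "is_tensor_functional I A \<phi> f \<longleftrightarrow>
     linear_functional (tensor_algebra I A) f \<and>
     (\<forall>x\<in>entry_families I A. f (simple_tensor I A x) =
        (\<Prod>s\<in>{s \<in> sites I. tilde_functional (A (fst s)) (\<phi> (fst s)) (x s) \<noteq> 1}.
           tilde_functional (A (fst s)) (\<phi> (fst s)) (x s)))"

definition tensor_functional ::
    "'i set \<Rightarrow> ('i \<Rightarrow> (complex, 'a) module) \<Rightarrow> ('i \<Rightarrow> 'a \<Rightarrow> complex)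
      \<Rightarrow> ('i, 'a) tensor \<Rightarrow> complex" where
  "tensor_functional I A \<phi> = (SOME f. is_tensor_functional I A \<phi> f)"

section \<open>Orthogonal replicas and the replica space\<close>

definition replica_P ::
    "'i set \<Rightarrow> ('i \<Rightarrow> (complex, 'a) module) \<Rightarrow> 'i \<Rightarrow> nat \<Rightarrow> ('i, 'a) tensor" where
  "replica_P I A i j =
     (if j = 0 then \<zero>\<^bsub>tensor_algebra I A\<^esub>
      else simple_tensor I A (\<lambda>(k, m)\<in>sites I.
        if k = i \<or> m \<le> j - 1 then \<one>\<^bsub>tilde (A k)\<^esub> else tilde_p (A k)))"

definition replica_p ::
    "'i set \<Rightarrow> ('i \<Rightarrow> (complex, 'a) module) \<Rightarrow> 'i \<Rightarrow> nat \<Rightarrow> ('i, 'a) tensor" where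
  "replica_p I A i j = replica_P I A i j \<ominus>\<^bsub>tensor_algebra I A\<^esub> replica_P I A i (j - 1)"

definition replica_iota ::
    "'i set \<Rightarrow> ('i \<Rightarrow> (complex, 'a) module) \<Rightarrow> 'i \<Rightarrow> nat \<Rightarrow> 'a \<Rightarrow> ('i, 'a) tensor" where
  "replica_iota I A i j a =
     simple_tensor I A (\<lambda>(k, m)\<in>sites I.
       if (k, m) = (i, j) then tilde_in (A k) a else \<one>\<^bsub>tilde (A k)\<^esub>)"

definition replica ::
    "'i set \<Rightarrow> ('i \<Rightarrow> (complex, 'a) module) \<Rightarrow> 'i \<Rightarrow> nat \<Rightarrow> 'a \<Rightarrow> ('i, 'a) tensor" where
  "replica I A i j a = replica_iota I A i j a \<otimes>\<^bsub>tensor_algebra I A\<^esub> replica_p I A i j"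

definition generated_subalgebra :: "(complex, 'a) module \<Rightarrow> 'a set \<Rightarrow> 'a set" where
  "generated_subalgebra A S =
     \<Inter>{B. subring B A \<and> (\<forall>c. \<forall>x\<in>B. c \<odot>\<^bsub>A\<^esub> x \<in> B) \<and> S \<subseteq> B}"

definition replica_algebra ::
    "'i set \<Rightarrow> ('i \<Rightarrow> (complex, 'a) module) \<Rightarrow> (complex, ('i, 'a) tensor) module" where
  "replica_algebra I A = (tensor_algebra I A)
     \<lparr>carrier := generated_subalgebra (tensor_algebra I A)
        {replica I A i j a | i j a. i \<in> I \<and> 1 \<le> j \<and> a \<in> carrier (A i)}\<rparr>"

definition replica_functional ::
    "'i set \<Rightarrow> ('i \<Rightarrow> (complex, 'a) module) \<Rightarrow> ('i \<Rightarrow> 'a \<Rightarrow> complex)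
      \<Rightarrow> ('i, 'a) tensor \<Rightarrow> complex" where
  "replica_functional I A \<phi> = restrict (tensor_functional I A \<phi>) (carrier (replica_algebra I A))"

section \<open>Motzkin words\<close>

definition motzkin_words :: "nat \<Rightarrow> nat list set" where
  "motzkin_words n =
     {w. length w = n \<and> w \<noteq> [] \<and> (\<forall>l\<in>set w. 1 \<le> l) \<and> hd w = 1 \<and> last w = 1 \<and>
         (\<forall>k. 0 < k \<and> k < n \<longrightarrow> \<bar>int (w ! k) - int (w ! (k - 1))\<bar> \<in> {0, 1})}"

text \<open>Labels are indexed from 1, whereas the letter \<open>j\<^sub>k\<close> of a word \<open>w\<close> is \<open>w ! (k - 1)\<close>.\<close>

definition labeled_motzkin_words :: "nat \<Rightarrow> (nat \<Rightarrow> 'i) \<Rightarrow> nat list set" where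
  "labeled_motzkin_words n i =
     {w \<in> motzkin_words n. \<forall>k\<in>{1..<n}. i k = i (Suc k) \<longrightarrow> w ! (k - 1) = w ! k}"

end

theory Submission
  imports Defs
begin

text \<open>On the left of an element \<open>b \<in> A\<^sub>i\<close>, the idempotent \<open>p\<^sub>i\<close> replaces \<open>b\<close> by the number
  \<open>\<phi>\<^sub>i b\<close>. Acting from the left, a product of replicas therefore produces from the unit tensor
  combinations of free Fock space vectors \<open>b\<^sub>1 \<otimes> \<dots> \<otimes> b\<^sub>r\<close>, where \<open>b\<^sub>m\<close> is centred, of label \<open>i\<^sub>m\<close>,
  sits at site \<open>(i\<^sub>m, m)\<close>, and \<open>i\<^sub>1 \<noteq> \<dots> \<noteq> i\<^sub>r\<close>. The projection \<open>p\<^sub>i(j)\<close> retains such a vector only if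
  \<open>r = j\<close> and \<open>i\<^sub>r = i\<close>, or \<open>r = j - 1\<close> and \<open>i\<^sub>r \<noteq> i\<close>, and then \<open>a(j)\<close> yields vectors of lengths \<open>j\<close>
  (with top label \<open>i\<close>) and \<open>j - 1\<close> (with top label different from \<open>i\<close>). Hence consecutive colors
  differ by at most one and agree if the labels agree; the rightmost color is 1 because the unit has
  length 0, and the leftmost is 1 because \<open>\<Phi>\<close> vanishes on vectors of positive length.\<close>

section \<open>Monoid algebras\<close>

text \<open>Two features of the definitions shape the proof. Both functionals are chosen by
  \<open>SOME\<close>, so nothing is known about them until some functional with the prescribed
  values has been exhibited; the work on monoid algebras, quotients and free products serves this
  purpose. Afterwards only linearity and the prescribed values are used. Moreover, replacing p b by
  the number \<phi> b is wrong in the algebra itself. It is legitimate only under the functional,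
  and the prescribed values give it only when the factor to the left of p b is p or an alternating
  word, possibly flanked by p. For this reason no Fock space representation is built: a vector is
  encoded by a simple tensor, the effect of X on it is observed only through \<open>pairing\<close>,
  that is, the value of \<Phi> on X times this tensor, and X is kept in \<open>good_span\<close>,
  the iterated differences of simple tensors whose entries are of the kind just described.\<close>

lemma complex_ring_simps [simp]:
  "carrier complex_ring = UNIV"
  "x \<otimes>\<^bsub>complex_ring\<^esub> y = x * y"
  "\<one>\<^bsub>complex_ring\<^esub> = 1"
  "\<zero>\<^bsub>complex_ring\<^esub> = 0"
  "x \<oplus>\<^bsub>complex_ring\<^esub> y = x + y"
  by (simp_all add: complex_ring_def)

lemma complex_ring_cring: "cring complex_ring"
proof (rule cringI)
  show "abelian_group complex_ring"
  proof (rule abelian_groupI)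
    fix x assume "x \<in> carrier complex_ring"
    show "\<exists>y\<in>carrier complex_ring. y \<oplus>\<^bsub>complex_ring\<^esub> x = \<zero>\<^bsub>complex_ring\<^esub>"
      by (rule bexI[of _ "- x"]) simp_all
  qed simp_all
  show "comm_monoid complex_ring"
    by (rule comm_monoidI) simp_all
qed (simp add: distrib_right)

lemma complex_algebraI:
  assumes "ring A"
    and "\<And>c x. x \<in> carrier A \<Longrightarrow> c \<odot>\<^bsub>A\<^esub> x \<in> carrier A"
    and "\<And>c d x. x \<in> carrier A \<Longrightarrow> (c + d) \<odot>\<^bsub>A\<^esub> x = c \<odot>\<^bsub>A\<^esub> x \<oplus>\<^bsub>A\<^esub> d \<odot>\<^bsub>A\<^esub> x"
    and "\<And>c x y. x \<in> carrier A \<Longrightarrow> y \<in> carrier A \<Longrightarrow>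
      c \<odot>\<^bsub>A\<^esub> (x \<oplus>\<^bsub>A\<^esub> y) = c \<odot>\<^bsub>A\<^esub> x \<oplus>\<^bsub>A\<^esub> c \<odot>\<^bsub>A\<^esub> y"
    and "\<And>c d x. x \<in> carrier A \<Longrightarrow> (c * d) \<odot>\<^bsub>A\<^esub> x = c \<odot>\<^bsub>A\<^esub> (d \<odot>\<^bsub>A\<^esub> x)"
    and "\<And>x. x \<in> carrier A \<Longrightarrow> 1 \<odot>\<^bsub>A\<^esub> x = x"
    and "\<And>c x y. x \<in> carrier A \<Longrightarrow> y \<in> carrier A \<Longrightarrow>
      (c \<odot>\<^bsub>A\<^esub> x) \<otimes>\<^bsub>A\<^esub> y = c \<odot>\<^bsub>A\<^esub> (x \<otimes>\<^bsub>A\<^esub> y)"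
    and "\<And>c x y. x \<in> carrier A \<Longrightarrow> y \<in> carrier A \<Longrightarrow>
      x \<otimes>\<^bsub>A\<^esub> (c \<odot>\<^bsub>A\<^esub> y) = c \<odot>\<^bsub>A\<^esub> (x \<otimes>\<^bsub>A\<^esub> y)"
  shows "complex_algebra A"
proof -
  interpret A: ring A by fact
  show ?thesis
    by (intro complex_algebra.intro complex_algebra_axioms.intro moduleI complex_ring_cring
        A.abelian_group_axioms assms(1)) (simp_all add: assms)
qed

text \<open>Removing one support point at a time writes \<open>f\<close> as a sum of point masses
  inside \<open>S\<close>. Bilinear identities in a monoid algebra thus reduce to identities between
  elements of the monoid.\<close>

lemma poly_mapping_single_induct [consumes 1, case_names zero single add]:
  assumes "Poly_Mapping.keys f \<subseteq> S"
    and "P 0"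
    and "\<And>x c. x \<in> S \<Longrightarrow> P (Poly_Mapping.single x c)"
    and "\<And>f g. Poly_Mapping.keys f \<subseteq> S \<Longrightarrow> Poly_Mapping.keys g \<subseteq> S \<Longrightarrow> P f \<Longrightarrow> P g \<Longrightarrow> P (f + g)"
  shows "P (f :: 'a \<Rightarrow>\<^sub>0 'b :: comm_monoid_add)"
proof -
  have "finite T \<Longrightarrow> Poly_Mapping.keys f = T \<Longrightarrow> T \<subseteq> S \<Longrightarrow> P f" for T and f :: "'a \<Rightarrow>\<^sub>0 'b"
  proof (induction T arbitrary: f rule: finite_induct)
    case empty
    then show ?case using assms(2) by simp
  next
    case (insert x T)
    define g where "g = Poly_Mapping.update x 0 f"
    have lg: "Poly_Mapping.lookup g y = (if y = x then 0 else Poly_Mapping.lookup f y)" for y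
      by (simp add: g_def lookup_update)
    have kg: "Poly_Mapping.keys g = T"
      using insert.prems insert.hyps by (auto simp: in_keys_iff lg set_eq_iff split: if_splits)
    have f: "f = g + Poly_Mapping.single x (Poly_Mapping.lookup f x)"
      by (rule poly_mapping_eqI) (simp add: lookup_add lg lookup_single when_def)
    show ?case
      using insert.prems insert.IH[OF kg]
      by (subst f, intro assms(3,4)) (auto simp: kg)
  qed
  then show ?thesis using assms(1) finite_keys by blast
qed

text \<open>A copy of \<open>Group.monoid\<close> under its own name. Facts on monoid algebras are
  stated in it and then used both for words in a free product and for entry families of
  tensors.\<close>

locale plain_monoid = Group.monoid G for G :: "'m monoid" (structure)

lemma monoid_algebra_simps [simp]:
  "carrier (monoid_algebra M) = {f. Poly_Mapping.keys f \<subseteq> carrier M}"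
  "\<one>\<^bsub>monoid_algebra M\<^esub> = Poly_Mapping.single \<one>\<^bsub>M\<^esub> 1"
  "\<zero>\<^bsub>monoid_algebra M\<^esub> = 0"
  "f \<oplus>\<^bsub>monoid_algebra M\<^esub> g = f + g"
  by (simp_all add: monoid_algebra_def)

lemma lookup_smult_monoid_algebra [simp]:
  "Poly_Mapping.lookup (c \<odot>\<^bsub>monoid_algebra M\<^esub> f) x = c * Poly_Mapping.lookup f x"
  by (simp add: monoid_algebra_def Poly_Mapping.map.rep_eq when_def)

lemma keys_smult_monoid_algebra:
  "Poly_Mapping.keys (c \<odot>\<^bsub>monoid_algebra M\<^esub> f) \<subseteq> Poly_Mapping.keys f"
  by (auto simp: in_keys_iff)

lemma smult_single_monoid_algebra [simp]:
  "c \<odot>\<^bsub>monoid_algebra M\<^esub> Poly_Mapping.single x d = Poly_Mapping.single x (c * d)"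
  by (rule poly_mapping_eqI) (simp add: lookup_single when_def)

lemma monoid_algebra_mult_add_left:
  "(f + g) \<otimes>\<^bsub>monoid_algebra M\<^esub> h = f \<otimes>\<^bsub>monoid_algebra M\<^esub> h + g \<otimes>\<^bsub>monoid_algebra M\<^esub> h"
  unfolding monoid_algebra_def monoid.simps
  by (rule setsum_keys_plus_distrib) (simp_all add: distrib_right single_add sum.distrib)

lemma monoid_algebra_mult_add_right:
  "f \<otimes>\<^bsub>monoid_algebra M\<^esub> (g + h) = f \<otimes>\<^bsub>monoid_algebra M\<^esub> g + f \<otimes>\<^bsub>monoid_algebra M\<^esub> h"
  unfolding monoid_algebra_def monoid.simps
  by (subst setsum_keys_plus_distrib) (simp_all add: distrib_left single_add sum.distrib)

lemma monoid_algebra_mult_zero [simp]: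
  "0 \<otimes>\<^bsub>monoid_algebra M\<^esub> f = 0" "f \<otimes>\<^bsub>monoid_algebra M\<^esub> 0 = 0"
  by (simp_all add: monoid_algebra_def)

lemma monoid_algebra_mult_single [simp]:
  "Poly_Mapping.single x c \<otimes>\<^bsub>monoid_algebra M\<^esub> Poly_Mapping.single y d
    = Poly_Mapping.single (x \<otimes>\<^bsub>M\<^esub> y) (c * d)"
  by (simp add: monoid_algebra_def)

lemmas monoid_algebra_distribs =
  monoid_algebra_mult_add_left monoid_algebra_mult_add_right

lemma (in plain_monoid) monoid_algebra_mult_closed:
  assumes "Poly_Mapping.keys f \<subseteq> carrier G" "Poly_Mapping.keys g \<subseteq> carrier G"
  shows "Poly_Mapping.keys (f \<otimes>\<^bsub>monoid_algebra G\<^esub> g) \<subseteq> carrier G"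
  using assms(1)
proof (induction f rule: poly_mapping_single_induct)
  case (single x c)
  show ?case
    using assms(2)
  proof (induction g rule: poly_mapping_single_induct)
    case (add f g)
    then show ?case
      using keys_add[of "Poly_Mapping.single x c \<otimes>\<^bsub>monoid_algebra G\<^esub> f"
          "Poly_Mapping.single x c \<otimes>\<^bsub>monoid_algebra G\<^esub> g"]
      by (auto simp: monoid_algebra_distribs)
  qed (use single in auto)
next
  case (add f h)
  then show ?case
    using keys_add[of "f \<otimes>\<^bsub>monoid_algebra G\<^esub> g" "h \<otimes>\<^bsub>monoid_algebra G\<^esub> g"]
    by (auto simp: monoid_algebra_distribs)
qed simp

lemma (in plain_monoid) monoid_algebra_assoc:
  assumes "Poly_Mapping.keys f \<subseteq> carrier G" "Poly_Mapping.keys g \<subseteq> carrier G"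
    "Poly_Mapping.keys h \<subseteq> carrier G"
  shows "(f \<otimes>\<^bsub>monoid_algebra G\<^esub> g) \<otimes>\<^bsub>monoid_algebra G\<^esub> h
    = f \<otimes>\<^bsub>monoid_algebra G\<^esub> (g \<otimes>\<^bsub>monoid_algebra G\<^esub> h)"
  using assms(1)
proof (induction f rule: poly_mapping_single_induct)
  case (single x c)
  show ?case
    using assms(2)
  proof (induction g rule: poly_mapping_single_induct)
    case (single y d)
    show ?case
      using assms(3) by (induction h rule: poly_mapping_single_induct)
        (use \<open>x \<in> carrier G\<close> single in \<open>auto simp: m_assoc monoid_algebra_distribs mult.assoc\<close>)
  qed (auto simp: monoid_algebra_distribs)
qed (auto simp: monoid_algebra_distribs)

lemma (in plain_monoid) monoid_algebra_ring: "ring (monoid_algebra G)"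
proof (rule ringI)
  show "abelian_group (monoid_algebra G)"
  proof (rule abelian_groupI)
    fix f assume f: "f \<in> carrier (monoid_algebra G)"
    show "\<exists>g\<in>carrier (monoid_algebra G). g \<oplus>\<^bsub>monoid_algebra G\<^esub> f = \<zero>\<^bsub>monoid_algebra G\<^esub>"
      by (rule bexI[of _ "- f"]) (use f in simp_all)
  qed (use keys_add in \<open>fastforce simp: add.assoc add.commute\<close>)+
  show "Group.monoid (monoid_algebra G)"
  proof (rule monoidI)
    fix f assume "f \<in> carrier (monoid_algebra G)"
    then have f: "Poly_Mapping.keys f \<subseteq> carrier G" by simp
    then show "\<one>\<^bsub>monoid_algebra G\<^esub> \<otimes>\<^bsub>monoid_algebra G\<^esub> f = f"
      by (induction f rule: poly_mapping_single_induct) (auto simp: monoid_algebra_distribs)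
    show "f \<otimes>\<^bsub>monoid_algebra G\<^esub> \<one>\<^bsub>monoid_algebra G\<^esub> = f"
      using f by (induction f rule: poly_mapping_single_induct) (auto simp: monoid_algebra_distribs)
  qed (simp_all add: monoid_algebra_assoc monoid_algebra_mult_closed)
qed (simp_all add: monoid_algebra_distribs)

lemma smult_add_monoid_algebra:
  "c \<odot>\<^bsub>monoid_algebra M\<^esub> (f + g) = c \<odot>\<^bsub>monoid_algebra M\<^esub> f + c \<odot>\<^bsub>monoid_algebra M\<^esub> g"
  by (rule poly_mapping_eqI) (simp add: lookup_add algebra_simps)

lemma smult_mult_left_monoid_algebra:
  "(c \<odot>\<^bsub>monoid_algebra M\<^esub> f) \<otimes>\<^bsub>monoid_algebra M\<^esub> g
    = c \<odot>\<^bsub>monoid_algebra M\<^esub> (f \<otimes>\<^bsub>monoid_algebra M\<^esub> g)"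
proof (induction f rule: poly_mapping_single_induct[OF subset_UNIV, case_names zero single add])
  case zero
  have "c \<odot>\<^bsub>monoid_algebra M\<^esub> 0 = 0" by (rule poly_mapping_eqI) simp
  then show ?case by simp
next
  case (single x d)
  show ?case
  proof (induction g rule: poly_mapping_single_induct[OF subset_UNIV, case_names zero single add])
    case zero
    have "c \<odot>\<^bsub>monoid_algebra M\<^esub> 0 = 0" by (rule poly_mapping_eqI) simp
    then show ?case by simp
  qed (auto simp: monoid_algebra_distribs smult_add_monoid_algebra mult.assoc)
qed (auto simp: monoid_algebra_distribs smult_add_monoid_algebra)

lemma smult_mult_right_monoid_algebra:
  "f \<otimes>\<^bsub>monoid_algebra M\<^esub> (c \<odot>\<^bsub>monoid_algebra M\<^esub> g)
    = c \<odot>\<^bsub>monoid_algebra M\<^esub> (f \<otimes>\<^bsub>monoid_algebra M\<^esub> g)"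
proof (induction f rule: poly_mapping_single_induct[OF subset_UNIV, case_names zero single add])
  case zero
  have "c \<odot>\<^bsub>monoid_algebra M\<^esub> 0 = 0" by (rule poly_mapping_eqI) simp
  then show ?case by simp
next
  case (single x d)
  show ?case
  proof (induction g rule: poly_mapping_single_induct[OF subset_UNIV, case_names zero single add])
    case zero
    have "c \<odot>\<^bsub>monoid_algebra M\<^esub> 0 = 0" by (rule poly_mapping_eqI) simp
    then show ?case by simp
  qed (auto simp: monoid_algebra_distribs smult_add_monoid_algebra algebra_simps)
qed (auto simp: monoid_algebra_distribs smult_add_monoid_algebra)

theorem (in plain_monoid) monoid_algebra_complex_algebra: "complex_algebra (monoid_algebra G)"
proof (rule complex_algebraI)
  fix c f assume "f \<in> carrier (monoid_algebra G)"
  then show "c \<odot>\<^bsub>monoid_algebra G\<^esub> f \<in> carrier (monoid_algebra G)"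
    using keys_smult_monoid_algebra by fastforce
next
  fix c d f
  show "(c + d) \<odot>\<^bsub>monoid_algebra G\<^esub> f
      = c \<odot>\<^bsub>monoid_algebra G\<^esub> f \<oplus>\<^bsub>monoid_algebra G\<^esub> d \<odot>\<^bsub>monoid_algebra G\<^esub> f"
    by (auto intro!: poly_mapping_eqI simp: lookup_add algebra_simps)
  show "(c * d) \<odot>\<^bsub>monoid_algebra G\<^esub> f
      = c \<odot>\<^bsub>monoid_algebra G\<^esub> (d \<odot>\<^bsub>monoid_algebra G\<^esub> f)"
    by (auto intro!: poly_mapping_eqI)
  show "1 \<odot>\<^bsub>monoid_algebra G\<^esub> f = f"
    by (auto intro!: poly_mapping_eqI)
qed (simp_all add: monoid_algebra_ring smult_add_monoid_algebra
  smult_mult_left_monoid_algebra smult_mult_right_monoid_algebra)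

section \<open>Quotients by ideals\<close>

lemma quotient_algebra_simps:
  "carrier (quotient_algebra A J) = carrier (A Quot J)"
  "x \<otimes>\<^bsub>quotient_algebra A J\<^esub> y = x \<otimes>\<^bsub>A Quot J\<^esub> y"
  "\<one>\<^bsub>quotient_algebra A J\<^esub> = \<one>\<^bsub>A Quot J\<^esub>"
  "\<zero>\<^bsub>quotient_algebra A J\<^esub> = \<zero>\<^bsub>A Quot J\<^esub>"
  "x \<oplus>\<^bsub>quotient_algebra A J\<^esub> y = x \<oplus>\<^bsub>A Quot J\<^esub> y"
  "c \<odot>\<^bsub>quotient_algebra A J\<^esub> X = (\<Union>x\<in>X. J +>\<^bsub>A\<^esub> (c \<odot>\<^bsub>A\<^esub> x))"
  by (simp_all add: quotient_algebra_def ring.extend_def module.fields_def)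

locale algebra_ideal = complex_algebra A + ideal J A for A (structure) and J
begin

abbreviation Q where "Q \<equiv> quotient_algebra A J"

text \<open>Because of the unit, c x is the product of c 1 and x, so a ring ideal is also a linear
  subspace. This makes scalar multiplication of cosets well defined.\<close>

lemma smult_mem_ideal: "x \<in> J \<Longrightarrow> c \<odot> x \<in> J"
proof -
  assume x: "x \<in> J"
  then have "(c \<odot> \<one>) \<otimes> x \<in> J" by (intro I_l_closed smult_closed) simp_all
  then show ?thesis using x by (simp add: smult_mult_left)
qed

lemma quotient_carrier_iff: "X \<in> carrier Q \<longleftrightarrow> (\<exists>x\<in>carrier A. X = J +> x)"
  by (auto simp: quotient_algebra_simps FactRing_simps)

lemma quotient_in_carrier [simp]: "x \<in> carrier A \<Longrightarrow> J +> x \<in> carrier Q"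
  by (auto simp: quotient_carrier_iff)

lemma quotient_mult [simp]:
  "\<lbrakk>x \<in> carrier A; y \<in> carrier A\<rbrakk> \<Longrightarrow> (J +> x) \<otimes>\<^bsub>Q\<^esub> (J +> y) = J +> (x \<otimes> y)"
  by (simp add: quotient_algebra_simps FactRing_simps rcoset_mult_add)

lemma quotient_add [simp]:
  "\<lbrakk>x \<in> carrier A; y \<in> carrier A\<rbrakk> \<Longrightarrow> (J +> x) \<oplus>\<^bsub>Q\<^esub> (J +> y) = J +> (x \<oplus> y)"
  by (simp add: quotient_algebra_simps FactRing_simps a_rcos_sum)

lemma quotient_one: "\<one>\<^bsub>Q\<^esub> = J +> \<one>"
  by (simp add: quotient_algebra_simps FactRing_simps)

text \<open>The union defining scalar multiplication runs over all representatives, but each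
  contributes the same coset: two of them differ by an element of \<open>J\<close>, which stays in
  \<open>J\<close> when scaled.\<close>

lemma quotient_smult [simp]:
  assumes x: "x \<in> carrier A"
  shows "c \<odot>\<^bsub>Q\<^esub> (J +> x) = J +> (c \<odot> x)"
proof -
  have "J +> (c \<odot> y) = J +> (c \<odot> x)" if "y \<in> J +> x" for y
  proof -
    from that obtain h where h: "h \<in> J" "y = h \<oplus> x"
      by (auto simp: a_r_coset_def')
    then have "c \<odot> y = c \<odot> h \<oplus> c \<odot> x"
      using x by (simp add: smult_r_distr)
    then have "c \<odot> y \<in> J +> (c \<odot> x)"
      using smult_mem_ideal[OF h(1)] by (auto simp: a_r_coset_def')
    then show ?thesis
      using x by (metis a_repr_independence' smult_closed complex_ring_simps(1) UNIV_I)
  qed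
  moreover have "x \<in> J +> x" using x by (rule a_rcos_self)
  ultimately show ?thesis
    unfolding quotient_algebra_simps(6) by (intro SUP_eq_const) blast+
qed

lemma quotient_ring: "ring Q"
proof -
  interpret Q: ring "A Quot J" by (rule quotient_is_ring)
  show ?thesis
  proof (rule ringI)
    show "abelian_group Q"
    proof (rule abelian_groupI)
      fix x assume "x \<in> carrier Q"
      then show "\<exists>y\<in>carrier Q. y \<oplus>\<^bsub>Q\<^esub> x = \<zero>\<^bsub>Q\<^esub>"
        by (intro bexI[of _ "\<ominus>\<^bsub>A Quot J\<^esub> x"]) (simp_all add: quotient_algebra_simps Q.l_neg)
    qed (simp_all add: quotient_algebra_simps Q.a_assoc, simp add: Q.a_comm)
    show "Group.monoid Q"
      by (rule monoidI) (simp_all add: quotient_algebra_simps Q.m_assoc)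
  qed (simp_all add: quotient_algebra_simps Q.l_distr Q.r_distr)
qed

lemma quotient_complex_algebra: "complex_algebra Q"
  using smult_l_distr smult_r_distr smult_assoc1 smult_one
  by (intro complex_algebraI quotient_ring)
    (auto simp: quotient_carrier_iff smult_mult_left smult_mult_right)

text \<open>The functional induced on the quotient, evaluated at an arbitrary representative; it is
  meaningful when \<open>f\<close> is linear and vanishes on \<open>J\<close>.\<close>

definition factor_functional :: "('a \<Rightarrow> complex) \<Rightarrow> 'a set \<Rightarrow> complex" where
  "factor_functional f X = f (SOME x. x \<in> X)"

lemma factor_functional_coset:
  assumes "linear_functional A f" "\<And>x. x \<in> J \<Longrightarrow> f x = 0" "x \<in> carrier A"
  shows "factor_functional f (J +> x) = f x"
proof -
  have "x \<in> J +> x" using assms(3) by (rule a_rcos_self)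
  then have "(SOME y. y \<in> J +> x) \<in> J +> x" by (rule someI)
  then obtain h where "h \<in> J" "(SOME y. y \<in> J +> x) = h \<oplus> x"
    by (auto simp: a_r_coset_def')
  then show ?thesis
    using assms by (simp add: factor_functional_def linear_functional_def)
qed

lemma factor_functional_linear:
  assumes "linear_functional A f" "\<And>x. x \<in> J \<Longrightarrow> f x = 0"
  shows "linear_functional Q (factor_functional f)"
  using assms(1)
  by (auto simp: linear_functional_def quotient_carrier_iff factor_functional_coset[OF assms])

end

section \<open>Linear functionals that vanish on a generated ideal\<close>

lemma (in complex_algebra) linear_functional_minus:
  assumes f: "linear_functional A f" and x: "x \<in> carrier A" and y: "y \<in> carrier A"
  shows "f (x \<ominus> y) = f x - f y"
proof -
  have "f ((x \<ominus> y) \<oplus> y) = f (x \<ominus> y) + f y"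
    using f x y by (simp add: linear_functional_def)
  moreover have "(x \<ominus> y) \<oplus> y = x" using x y by (simp add: a_minus_def a_assoc l_neg)
  ultimately show ?thesis by simp
qed

lemma (in complex_algebra) algebra_ideal_genideal:
  assumes "R \<subseteq> carrier A"
  shows "algebra_ideal A (genideal A R)"
  by (intro algebra_ideal.intro complex_algebra_axioms genideal_ideal assms)

text \<open>The elements \<open>x\<close> for which \<open>f\<close> vanishes on all \<open>a x b\<close> form an ideal.\<close>

lemma (in complex_algebra) functional_vanishes_genideal:
  assumes f: "linear_functional A f" and R: "R \<subseteq> carrier A"
    and vanish: "\<And>a r b. \<lbrakk>a \<in> carrier A; r \<in> R; b \<in> carrier A\<rbrakk> \<Longrightarrow> f (a \<otimes> r \<otimes> b) = 0"
    and x: "x \<in> genideal A R"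
  shows "f x = 0"
proof -
  define K where "K = {x \<in> carrier A. \<forall>a\<in>carrier A. \<forall>b\<in>carrier A. f (a \<otimes> x \<otimes> b) = 0}"
  have f0: "f \<zero> = 0"
    using f zero_closed unfolding linear_functional_def by (metis add_cancel_right_right l_zero)
  have "ideal K A"
  proof (rule idealI)
    show "subgroup K (add_monoid A)"
    proof (rule subgroup.intro)
      fix x assume x: "x \<in> K"
      have "f (a \<otimes> (\<ominus> x) \<otimes> b) = 0" if "a \<in> carrier A" "b \<in> carrier A" for a b
        using that x linear_functional_minus[OF f, of \<zero> "a \<otimes> x \<otimes> b"]
        by (simp add: K_def a_minus_def r_minus l_minus f0)
      then show "inv\<^bsub>add_monoid A\<^esub> x \<in> K"
        using x by (simp add: K_def flip: a_inv_def)
    qed (use f in \<open>auto simp: K_def r_distr l_distr f0 linear_functional_def\<close>)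
    fix x y assume "x \<in> K" and "y \<in> carrier A"
    then have xy: "x \<in> carrier A" "y \<in> carrier A"
      and fx: "\<And>a b. a \<in> carrier A \<Longrightarrow> b \<in> carrier A \<Longrightarrow> f (a \<otimes> x \<otimes> b) = 0"
      by (auto simp: K_def)
    show "y \<otimes> x \<in> K"
      using xy fx by (simp add: K_def flip: m_assoc)
    show "x \<otimes> y \<in> K"
      using xy fx by (simp add: K_def m_assoc)
  qed (rule ring_axioms)
  moreover have "R \<subseteq> K" using R vanish by (auto simp: K_def)
  ultimately have "x \<in> K" using x genideal_minimal by blast
  then have "f (\<one> \<otimes> x \<otimes> \<one>) = 0" "x \<in> carrier A" unfolding K_def by blast+
  then show ?thesis by simp
qed

definition monoid_functional :: "('m \<Rightarrow> complex) \<Rightarrow> ('m \<Rightarrow>\<^sub>0 complex) \<Rightarrow> complex" where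
  "monoid_functional h f = (\<Sum>x\<in>Poly_Mapping.keys f. Poly_Mapping.lookup f x * h x)"

lemma monoid_functional_single [simp]: "monoid_functional h (Poly_Mapping.single x c) = c * h x"
  by (simp add: monoid_functional_def)

lemma monoid_functional_add:
  "monoid_functional h (f + g) = monoid_functional h f + monoid_functional h g"
  unfolding monoid_functional_def
  by (rule setsum_keys_plus_distrib) (simp_all add: distrib_right)

lemma monoid_functional_smult:
  "monoid_functional h (c \<odot>\<^bsub>monoid_algebra M\<^esub> f) = c * monoid_functional h f"
proof -
  \<comment> \<open>For c = 0 the support shrinks, so both sums are compared over the support of
    \<open>f\<close>.\<close>
  have "monoid_functional h (c \<odot>\<^bsub>monoid_algebra M\<^esub> f)
      = (\<Sum>x\<in>Poly_Mapping.keys f. Poly_Mapping.lookup (c \<odot>\<^bsub>monoid_algebra M\<^esub> f) x * h x)"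
    unfolding monoid_functional_def
    by (rule sum.mono_neutral_left) (auto simp: keys_smult_monoid_algebra[THEN subsetD] in_keys_iff)
  then show ?thesis by (simp add: monoid_functional_def sum_distrib_left mult.assoc)
qed

lemma monoid_functional_linear: "linear_functional (monoid_algebra M) (monoid_functional h)"
  by (simp add: linear_functional_def monoid_functional_add monoid_functional_smult)

text \<open>By bilinearity the two multipliers of a relation may be taken from the monoid. Descent
  to the quotient thereby becomes a statement about \<open>h\<close> on products with fixed outer
  factors \<open>u\<close> and \<open>v\<close>.\<close>

lemma (in plain_monoid) monoid_functional_vanishes_genideal:
  assumes R: "R \<subseteq> carrier (monoid_algebra G)"
    and vanish: "\<And>u r v. \<lbrakk>u \<in> carrier G; r \<in> R; v \<in> carrier G\<rbrakk> \<Longrightarrow>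
      monoid_functional h (Poly_Mapping.single u 1 \<otimes>\<^bsub>monoid_algebra G\<^esub> r
        \<otimes>\<^bsub>monoid_algebra G\<^esub> Poly_Mapping.single v 1) = 0"
    and x: "x \<in> genideal (monoid_algebra G) R"
  shows "monoid_functional h x = 0"
proof -
  interpret F: complex_algebra "monoid_algebra G" by (rule monoid_algebra_complex_algebra)
  have "monoid_functional h (a \<otimes>\<^bsub>monoid_algebra G\<^esub> r \<otimes>\<^bsub>monoid_algebra G\<^esub> b) = 0"
    if "a \<in> carrier (monoid_algebra G)" and r: "r \<in> R" and "b \<in> carrier (monoid_algebra G)" for a r b
  proof -
    have "Poly_Mapping.keys a \<subseteq> carrier G" using that by simp
    then show ?thesis
    proof (induction a rule: poly_mapping_single_induct)
      case (single u c)
      have b: "Poly_Mapping.keys b \<subseteq> carrier G" using that by simp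
      then show ?case
      proof (induction b rule: poly_mapping_single_induct)
        case (single v d)
        have "Poly_Mapping.single u c = c \<odot>\<^bsub>monoid_algebra G\<^esub> Poly_Mapping.single u 1"
          "Poly_Mapping.single v d = d \<odot>\<^bsub>monoid_algebra G\<^esub> Poly_Mapping.single v 1"
          by simp_all
        then show ?case
          using vanish[OF \<open>u \<in> carrier G\<close> r single]
          by (simp only: smult_mult_left_monoid_algebra smult_mult_right_monoid_algebra
              monoid_functional_smult) simp
      qed (simp_all add: monoid_functional_def[of h 0] monoid_algebra_distribs monoid_functional_add)
    qed (simp_all add: monoid_functional_def[of h 0] monoid_algebra_distribs monoid_functional_add)
  qed
  then show ?thesis
    using F.functional_vanishes_genideal[OF monoid_functional_linear R _ x] by blast
qed

lemma (in algebra_ideal) coset_eqI: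
  assumes "x \<in> carrier A" "y \<in> carrier A" "x \<ominus> y \<in> J"
  shows "J +> x = J +> y"
  using a_rcos_module_minus[OF ring_axioms assms(2,1)] assms a_repr_independence' by auto

lemma (in plain_monoid) monoid_algebra_minus [simp]:
  assumes "Poly_Mapping.keys f \<subseteq> carrier G" "Poly_Mapping.keys g \<subseteq> carrier G"
  shows "f \<ominus>\<^bsub>monoid_algebra G\<^esub> g = f - g"
proof -
  interpret F: complex_algebra "monoid_algebra G" by (rule monoid_algebra_complex_algebra)
  have "\<ominus>\<^bsub>monoid_algebra G\<^esub> g = - g"
    by (rule F.minus_equality) (use assms in auto)
  then show ?thesis by (simp add: a_minus_def)
qed

lemma monoid_algebra_mult_diff:
  "(f - g) \<otimes>\<^bsub>monoid_algebra M\<^esub> h = f \<otimes>\<^bsub>monoid_algebra M\<^esub> h - g \<otimes>\<^bsub>monoid_algebra M\<^esub> h"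
  "f \<otimes>\<^bsub>monoid_algebra M\<^esub> (g - h) = f \<otimes>\<^bsub>monoid_algebra M\<^esub> g - f \<otimes>\<^bsub>monoid_algebra M\<^esub> h"
  using monoid_algebra_mult_add_left[of M "f - g" g h]
    monoid_algebra_mult_add_right[of M f "g - h" h] by simp_all

lemma monoid_functional_diff:
  "monoid_functional h (f - g) = monoid_functional h f - monoid_functional h g"
  using monoid_functional_add[of h "f - g" g] by simp

section \<open>Free products\<close>

lemma Inl_Inr_in_Plus [simp]:
  "Inl x \<in> S <+> T \<longleftrightarrow> x \<in> S" "Inr y \<in> S <+> T \<longleftrightarrow> y \<in> T"
  by auto

lemma free_monoid_simps [simp]:
  "carrier (free_monoid S) = lists S"
  "u \<otimes>\<^bsub>free_monoid S\<^esub> v = u @ v"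
  "\<one>\<^bsub>free_monoid S\<^esub> = []"
  by (simp_all add: free_monoid_def)

lemma free_monoid_monoid: "plain_monoid (free_monoid S)"
  unfolding plain_monoid_def by (rule monoidI) simp_all

lemma keys_plus_subset:
  "Poly_Mapping.keys f \<subseteq> S \<Longrightarrow> Poly_Mapping.keys g \<subseteq> S \<Longrightarrow> Poly_Mapping.keys (f + g) \<subseteq> S"
  using keys_add[of f g] by blast

lemma hom_relationsI:
  "\<lbrakk>x \<in> carrier A; y \<in> carrier A\<rbrakk> \<Longrightarrow>
    letter (l (x \<oplus>\<^bsub>A\<^esub> y)) \<ominus>\<^bsub>F\<^esub> (letter (l x) \<oplus>\<^bsub>F\<^esub> letter (l y)) \<in> hom_relations F A l"
  "x \<in> carrier A \<Longrightarrow> letter (l (c \<odot>\<^bsub>A\<^esub> x)) \<ominus>\<^bsub>F\<^esub> c \<odot>\<^bsub>F\<^esub> letter (l x) \<in> hom_relations F A l"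
  "\<lbrakk>x \<in> carrier A; y \<in> carrier A\<rbrakk> \<Longrightarrow>
    letter (l (x \<otimes>\<^bsub>A\<^esub> y)) \<ominus>\<^bsub>F\<^esub> letter (l x) \<otimes>\<^bsub>F\<^esub> letter (l y) \<in> hom_relations F A l"
  "letter (l \<one>\<^bsub>A\<^esub>) \<ominus>\<^bsub>F\<^esub> \<one>\<^bsub>F\<^esub> \<in> hom_relations F A l"
  unfolding hom_relations_def by blast+

lemma hom_relations_cases :
  fixes F A and S :: "'g set" and l :: "'a \<Rightarrow> 'g"
  defines "F \<equiv> monoid_algebra (free_monoid S)"
  assumes "complex_algebra A" and l: "l ` carrier A \<subseteq> S"
    and r: "r \<in> hom_relations F A l"
  obtains x y where "x \<in> carrier A" "y \<in> carrier A"
      "r = letter (l (x \<oplus>\<^bsub>A\<^esub> y)) - (letter (l x) + letter (l y))"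
    | c x where "x \<in> carrier A"
      "r = letter (l (c \<odot>\<^bsub>A\<^esub> x)) - Poly_Mapping.single [l x] c"
    | x y where "x \<in> carrier A" "y \<in> carrier A"
      "r = letter (l (x \<otimes>\<^bsub>A\<^esub> y)) - Poly_Mapping.single [l x, l y] 1"
    | "r = letter (l \<one>\<^bsub>A\<^esub>) - Poly_Mapping.single [] 1"
proof -
  interpret A: complex_algebra A by fact
  interpret S: plain_monoid "free_monoid S" by (rule free_monoid_monoid)
  show ?thesis
    using r that l unfolding hom_relations_def F_def
    by (auto simp: keys_plus_subset image_subset_iff)
qed

lemma hom_relations_carrier:
  assumes "complex_algebra A" and l: "l ` carrier A \<subseteq> S"
  shows "hom_relations (monoid_algebra (free_monoid S)) A l \<subseteq> carrier (monoid_algebra (free_monoid S))"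
proof -
  interpret A: complex_algebra A by fact
  interpret S: plain_monoid "free_monoid S" by (rule free_monoid_monoid)
  interpret F: complex_algebra "monoid_algebra (free_monoid S)"
    by (rule S.monoid_algebra_complex_algebra)
  have single: "Poly_Mapping.single [l x] c \<in> carrier (monoid_algebra (free_monoid S))"
      "Poly_Mapping.single [l x, l y] c \<in> carrier (monoid_algebra (free_monoid S))"
    if "x \<in> carrier A" "y \<in> carrier A" for x y c
    using l that by auto
  show ?thesis
    unfolding hom_relations_def
    by (auto simp del: monoid_algebra_simps
        intro!: single F.minus_closed F.add.m_closed F.m_closed F.smult_closed F.one_closed)
qed

text \<open>The last four hypotheses are the four kinds of relation read off between fixed words
  \<open>u\<close> and \<open>v\<close>: there \<open>h\<close> must not distinguish an operation
  performed in \<open>A\<close> from the same operation performed in the free algebra.\<close>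

lemma hom_relations_vanish:
  fixes S :: "'g set" and l :: "'a \<Rightarrow> 'g"
  defines "F \<equiv> monoid_algebra (free_monoid S)"
  assumes A: "complex_algebra A" "l ` carrier A \<subseteq> S"
    and r: "r \<in> hom_relations F A l"
    and add: "\<And>x y. x \<in> carrier A \<Longrightarrow> y \<in> carrier A \<Longrightarrow>
      h (u @ [l (x \<oplus>\<^bsub>A\<^esub> y)] @ v) = h (u @ [l x] @ v) + h (u @ [l y] @ v)"
    and smult: "\<And>c x. x \<in> carrier A \<Longrightarrow> h (u @ [l (c \<odot>\<^bsub>A\<^esub> x)] @ v) = c * h (u @ [l x] @ v)"
    and mult: "\<And>x y. x \<in> carrier A \<Longrightarrow> y \<in> carrier A \<Longrightarrow>
      h (u @ [l (x \<otimes>\<^bsub>A\<^esub> y)] @ v) = h (u @ [l x, l y] @ v)"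
    and one: "h (u @ [l \<one>\<^bsub>A\<^esub>] @ v) = h (u @ v)"
  shows "monoid_functional h (Poly_Mapping.single u 1 \<otimes>\<^bsub>F\<^esub> r \<otimes>\<^bsub>F\<^esub> Poly_Mapping.single v 1) = 0"
proof -
  note expand = F_def monoid_algebra_distribs monoid_algebra_mult_diff monoid_functional_diff
    monoid_functional_add
  note cases = hom_relations_cases[OF A r[unfolded F_def], case_names add smult mult one]
  show ?thesis
  proof (cases rule: cases)
    case (add x y)
    show ?thesis unfolding add(3) using assms(5)[OF add(1,2)] by (simp add: expand)
  next
    case (smult c x)
    show ?thesis unfolding smult(2) using assms(6)[OF smult(1)] by (simp add: expand)
  next
    case (mult x y)
    show ?thesis unfolding mult(3) using assms(7)[OF mult(1,2)] by (simp add: expand)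
  next
    case one
    show ?thesis unfolding one using assms(8) by (simp add: expand)
  qed
qed

locale algebra_pair = A: complex_algebra A + B: complex_algebra B
  for A :: "(complex, 'a) module" and B :: "(complex, 'b) module"
begin

abbreviation F where "F \<equiv> free_product_cover A B"
abbreviation J where "J \<equiv> free_product_ideal A B"

definition relations where "relations = hom_relations F A Inl \<union> hom_relations F B Inr"

sublocale words: plain_monoid "free_monoid (carrier A <+> carrier B)"
  by (rule free_monoid_monoid)

lemma relations_carrier: "relations \<subseteq> carrier F"
  unfolding relations_def free_product_cover_def
  by (intro Un_least hom_relations_carrier A.complex_algebra_axioms B.complex_algebra_axioms) auto

sublocale F: complex_algebra F
  unfolding free_product_cover_def by (rule words.monoid_algebra_complex_algebra)

lemma J_eq: "J = genideal F relations"
  by (simp add: free_product_ideal_def relations_def Let_def)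

sublocale J: algebra_ideal F J
  unfolding J_eq by (rule F.algebra_ideal_genideal[OF relations_carrier])

lemma complex_algebra_free_product: "complex_algebra (free_product A B)"
  unfolding free_product_def by (rule J.quotient_complex_algebra)

lemma single_in_cover [simp]:
  "w \<in> lists (carrier A <+> carrier B) \<Longrightarrow> Poly_Mapping.single w c \<in> carrier F"
  by (auto simp: free_product_cover_def)

definition word_class :: "('a + 'b) list \<Rightarrow> (('a + 'b) list \<Rightarrow>\<^sub>0 complex) set" where
  "word_class w = J +>\<^bsub>F\<^esub> Poly_Mapping.single w 1"

lemma free_product_in_eq: "free_product_in A B g = word_class [g]"
  by (simp add: free_product_in_def word_class_def)

lemma word_class_closed [simp]:
  "w \<in> lists (carrier A <+> carrier B) \<Longrightarrow> word_class w \<in> carrier (free_product A B)"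
  by (simp add: word_class_def free_product_def)

lemma word_class_mult:
  assumes "u \<in> lists (carrier A <+> carrier B)" "v \<in> lists (carrier A <+> carrier B)"
  shows "word_class u \<otimes>\<^bsub>free_product A B\<^esub> word_class v = word_class (u @ v)"
  using assms J.quotient_mult[of "Poly_Mapping.single u 1" "Poly_Mapping.single v 1"]
  by (simp add: word_class_def free_product_def) (simp add: free_product_cover_def)

lemma word_class_Nil: "word_class [] = \<one>\<^bsub>free_product A B\<^esub>"
  by (simp add: word_class_def free_product_def J.quotient_one) (simp add: free_product_cover_def)

lemma relation_in_J:
  "r \<in> hom_relations F A Inl \<Longrightarrow> r \<in> J" "r \<in> hom_relations F B Inr \<Longrightarrow> r \<in> J"
  using F.genideal_self[OF relations_carrier] by (auto simp: J_eq relations_def)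

lemma free_product_in_Inl:
  assumes "x \<in> carrier A" "y \<in> carrier A"
  shows "free_product_in A B (Inl (x \<oplus>\<^bsub>A\<^esub> y))
      = free_product_in A B (Inl x) \<oplus>\<^bsub>free_product A B\<^esub> free_product_in A B (Inl y)"
    and "free_product_in A B (Inl (c \<odot>\<^bsub>A\<^esub> x)) = c \<odot>\<^bsub>free_product A B\<^esub> free_product_in A B (Inl x)"
    and "free_product_in A B (Inl (x \<otimes>\<^bsub>A\<^esub> y))
      = free_product_in A B (Inl x) \<otimes>\<^bsub>free_product A B\<^esub> free_product_in A B (Inl y)"
    and "free_product_in A B (Inl \<one>\<^bsub>A\<^esub>) = \<one>\<^bsub>free_product A B\<^esub>"
proof -
  have "J +>\<^bsub>F\<^esub> letter (Inl (x \<oplus>\<^bsub>A\<^esub> y)) = J +>\<^bsub>F\<^esub> (letter (Inl x) \<oplus>\<^bsub>F\<^esub> letter (Inl y))"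
    using assms by (intro J.coset_eqI relation_in_J(1)) (simp_all add: hom_relationsI)
  then show "free_product_in A B (Inl (x \<oplus>\<^bsub>A\<^esub> y))
      = free_product_in A B (Inl x) \<oplus>\<^bsub>free_product A B\<^esub> free_product_in A B (Inl y)"
    using assms by (simp add: free_product_in_def free_product_def)
  have "J +>\<^bsub>F\<^esub> letter (Inl (c \<odot>\<^bsub>A\<^esub> x)) = J +>\<^bsub>F\<^esub> (c \<odot>\<^bsub>F\<^esub> letter (Inl x))"
    using assms by (intro J.coset_eqI relation_in_J(1)) (simp_all add: hom_relationsI)
  then show "free_product_in A B (Inl (c \<odot>\<^bsub>A\<^esub> x)) = c \<odot>\<^bsub>free_product A B\<^esub> free_product_in A B (Inl x)"
    using assms by (simp add: free_product_in_def free_product_def)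
  have "J +>\<^bsub>F\<^esub> letter (Inl (x \<otimes>\<^bsub>A\<^esub> y)) = J +>\<^bsub>F\<^esub> (letter (Inl x) \<otimes>\<^bsub>F\<^esub> letter (Inl y))"
    using assms by (intro J.coset_eqI relation_in_J(1)) (simp_all add: hom_relationsI)
  then show "free_product_in A B (Inl (x \<otimes>\<^bsub>A\<^esub> y))
      = free_product_in A B (Inl x) \<otimes>\<^bsub>free_product A B\<^esub> free_product_in A B (Inl y)"
    using assms by (simp add: free_product_in_def free_product_def)
  have "J +>\<^bsub>F\<^esub> letter (Inl \<one>\<^bsub>A\<^esub>) = J +>\<^bsub>F\<^esub> \<one>\<^bsub>F\<^esub>"
    by (intro J.coset_eqI relation_in_J(1)) (simp_all add: hom_relationsI)
  then show "free_product_in A B (Inl \<one>\<^bsub>A\<^esub>) = \<one>\<^bsub>free_product A B\<^esub>"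
    by (simp add: free_product_in_def free_product_def J.quotient_one)
qed

text \<open>Carries (0, 1)(0, 1) = (0, 1) over to the free product, which is the idempotence of
  \<open>tilde_p\<close>.\<close>

lemma free_product_in_Inr_mult:
  assumes "x \<in> carrier B" "y \<in> carrier B"
  shows "free_product_in A B (Inr (x \<otimes>\<^bsub>B\<^esub> y))
      = free_product_in A B (Inr x) \<otimes>\<^bsub>free_product A B\<^esub> free_product_in A B (Inr y)"
proof -
  have "J +>\<^bsub>F\<^esub> letter (Inr (x \<otimes>\<^bsub>B\<^esub> y)) = J +>\<^bsub>F\<^esub> (letter (Inr x) \<otimes>\<^bsub>F\<^esub> letter (Inr y))"
    using assms by (intro J.coset_eqI relation_in_J(2)) (simp_all add: hom_relationsI)
  then show ?thesis
    using assms by (simp add: free_product_in_def free_product_def)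
qed

end

section \<open>The functional on the algebra with an adjoined idempotent\<close>

lemma idem_algebra_simps [simp]:
  "carrier idem_algebra = UNIV"
  "(a, b) \<otimes>\<^bsub>idem_algebra\<^esub> (a', b') = (a * a', a * b' + b * a' + b * b')"
  "\<one>\<^bsub>idem_algebra\<^esub> = (1, 0)"
  "\<zero>\<^bsub>idem_algebra\<^esub> = (0, 0)"
  "(a, b) \<oplus>\<^bsub>idem_algebra\<^esub> (a', b') = (a + a', b + b')"
  "c \<odot>\<^bsub>idem_algebra\<^esub> (a, b) = (c * a, c * b)"
  by (simp_all add: idem_algebra_def)

lemma idem_algebra_complex_algebra: "complex_algebra idem_algebra"
proof (rule complex_algebraI)
  show "ring idem_algebra"
  proof (rule ringI)
    show "abelian_group idem_algebra"
    proof (rule abelian_groupI)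
      fix x :: "complex \<times> complex"
      show "\<exists>y\<in>carrier idem_algebra. y \<oplus>\<^bsub>idem_algebra\<^esub> x = \<zero>\<^bsub>idem_algebra\<^esub>"
        by (rule bexI[of _ "(- fst x, - snd x)"]) (cases x, simp_all)
    qed (auto simp: add.commute add.assoc)
    show "Group.monoid idem_algebra"
      by (rule monoidI) (auto simp: algebra_simps)
  qed (auto simp: algebra_simps)
qed (auto simp: algebra_simps)

context nc_probability_space begin

abbreviation letters :: "('a + complex \<times> complex) set" where
  "letters \<equiv> Sum_Type.Plus (carrier A) UNIV"

sublocale pair: algebra_pair A idem_algebra
  by (intro algebra_pair.intro complex_algebra_axioms idem_algebra_complex_algebra)

sublocale tilde: complex_algebra "tilde A"
  unfolding tilde_def by (rule pair.complex_algebra_free_product)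

lemma functional_simps [simp]:
  "\<lbrakk>x \<in> carrier A; y \<in> carrier A\<rbrakk> \<Longrightarrow> \<phi> (x \<oplus> y) = \<phi> x + \<phi> y"
  "x \<in> carrier A \<Longrightarrow> \<phi> (c \<odot> x) = c * \<phi> x"
  "\<phi> \<one> = 1"
  using functional_linear functional_one by (simp_all add: linear_functional_def)

lemma unit_smult [simp]: "x \<in> carrier A \<Longrightarrow> 1 \<odot> x = x"
  using smult_one by simp

lemma zero_smult [simp]: "x \<in> carrier A \<Longrightarrow> 0 \<odot> x = \<zero>"
  using smult_l_null by simp

text \<open>The algebra \<open>tilde A\<close> acts on \<open>A\<close>: elements of \<open>A\<close> by left multiplication and \<open>p\<close> as the
  projection \<open>b \<mapsto> \<phi> b \<one>\<close>. The functional is \<open>x \<mapsto> \<phi> (x \<one>)\<close>.\<close>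

fun act :: "'a + complex \<times> complex \<Rightarrow> 'a \<Rightarrow> 'a" where
  "act (Inl a) b = a \<otimes> b"
| "act (Inr (c, d)) b = c \<odot> b \<oplus> (d * \<phi> b) \<odot> \<one>"

definition word_value where "word_value w = \<phi> (foldr act w \<one>)"

lemma act_closed: "\<lbrakk>g \<in> letters; b \<in> carrier A\<rbrakk> \<Longrightarrow> act g b \<in> carrier A"
  by (cases g) auto

lemma foldr_act_closed:
  "\<lbrakk>w \<in> lists letters; b \<in> carrier A\<rbrakk> \<Longrightarrow> foldr act w b \<in> carrier A"
  by (induction w) (auto intro!: act_closed)

lemma act_linear:
  assumes "g \<in> letters" "x \<in> carrier A" "y \<in> carrier A"
  shows "act g (x \<oplus> y) = act g x \<oplus> act g y" "act g (c \<odot> x) = c \<odot> act g x"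
proof -
  show "act g (x \<oplus> y) = act g x \<oplus> act g y"
    using assms
    by (cases g) (auto simp: r_distr smult_r_distr smult_l_distr[simplified] distrib_left
        a_assoc a_lcomm)
  show "act g (c \<odot> x) = c \<odot> act g x"
    using assms smult_assoc1
    by (cases g) (auto simp: smult_mult_right smult_r_distr mult.left_commute mult.commute
        simp flip: smult_assoc1[simplified])
qed

lemma foldr_act_linear:
  assumes "w \<in> lists letters" "x \<in> carrier A" "y \<in> carrier A"
  shows "foldr act w (x \<oplus> y) = foldr act w x \<oplus> foldr act w y"
    "foldr act w (c \<odot> x) = c \<odot> foldr act w x"
  using assms(1) by (induction w) (use assms in \<open>auto simp: act_linear foldr_act_closed\<close>)

text \<open>The right word \<open>v\<close> produces a vector \<open>t\<close> of \<open>A\<close>,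
  and the left word \<open>u\<close> followed by \<phi> is a linear functional \<open>U\<close>.
  Since the operators \<open>act\<close> respect sums, multiples, products and units of both
  factors, every relation evaluates to zero between \<open>U\<close> and \<open>t\<close>.\<close>

lemma relation_vanish:
  assumes w: "u \<in> lists letters" "v \<in> lists letters"
    and r: "r \<in> pair.relations"
  shows "monoid_functional word_value
    (Poly_Mapping.single u 1 \<otimes>\<^bsub>pair.F\<^esub> r \<otimes>\<^bsub>pair.F\<^esub> Poly_Mapping.single v 1) = 0"
proof -
  define t where "t = foldr act v \<one>"
  define U where "U b = \<phi> (foldr act u b)" for b
  have t: "t \<in> carrier A" unfolding t_def by (rule foldr_act_closed) (use w in auto)
  have U: "U (x \<oplus> y) = U x + U y" "U (c \<odot> x) = c * U x"
    if "x \<in> carrier A" "y \<in> carrier A" for x y c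
    using that w by (simp_all add: U_def foldr_act_linear foldr_act_closed)
  have val: "word_value (u @ w @ v) = U (foldr act w t)" for w
    by (simp add: word_value_def U_def t_def)
  have val_Nil: "word_value (u @ v) = U t"
    using val[of "[]"] by simp
  from r consider "r \<in> hom_relations pair.F A Inl" | "r \<in> hom_relations pair.F idem_algebra Inr"
    by (auto simp: pair.relations_def)
  then show ?thesis
  proof cases
    case 1
    then show ?thesis
      unfolding free_product_cover_def
      by (rule hom_relations_vanish[OF complex_algebra_axioms, rotated])
        (use t in \<open>auto simp del: append_Cons append_Nil simp add: val val_Nil U l_distr
          smult_mult_left m_assoc\<close>)
  next
    case 2
    have act_Inr: "act (Inr x) b = fst x \<odot> b \<oplus> (snd x * \<phi> b) \<odot> \<one>" for x b
      by (cases x) simp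
    have UI: "U (act (Inr x) b) = fst x * U b + snd x * \<phi> b * U \<one>" if "b \<in> carrier A" for x b
      using that by (simp add: act_Inr U)
    \<comment> \<open>The product of the two p-coefficients comes out right because \<phi> \<one> =
      1, which makes the operator of p idempotent.\<close>
    have compose: "act (Inr (x \<otimes>\<^bsub>idem_algebra\<^esub> y)) t = act (Inr x) (act (Inr y) t)" for x y
      using t smult_assoc1[simplified]
      by (cases x; cases y) (simp add: smult_r_distr smult_l_distr[simplified] algebra_simps a_assoc)
    show ?thesis
      unfolding free_product_cover_def
    proof (rule hom_relations_vanish[OF idem_algebra_complex_algebra])
      show "r \<in> hom_relations (monoid_algebra (free_monoid (Sum_Type.Plus (carrier A)
          (carrier idem_algebra)))) idem_algebra Inr"
        using 2 by (simp add: free_product_cover_def)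
      show "word_value (u @ [Inr (x \<oplus>\<^bsub>idem_algebra\<^esub> y)] @ v)
          = word_value (u @ [Inr x] @ v) + word_value (u @ [Inr y] @ v)" for x y
        unfolding val using UI[OF t] by (cases x; cases y) (simp add: algebra_simps del: act.simps)
      show "word_value (u @ [Inr (c \<odot>\<^bsub>idem_algebra\<^esub> x)] @ v) = c * word_value (u @ [Inr x] @ v)" for c x
        unfolding val using UI[OF t] by (cases x) (simp add: algebra_simps del: act.simps)
      show "word_value (u @ [Inr (x \<otimes>\<^bsub>idem_algebra\<^esub> y)] @ v) = word_value (u @ [Inr x, Inr y] @ v)" for x y
        unfolding val using compose[of x y] by simp
      show "word_value (u @ [Inr \<one>\<^bsub>idem_algebra\<^esub>] @ v) = word_value (u @ v)"
        unfolding val val_Nil using t by simp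
    qed auto
  qed
qed

definition tilde_value :: "'a tilde \<Rightarrow> complex" where
  "tilde_value = pair.J.factor_functional (monoid_functional word_value)"

lemma vanish_on_J: "x \<in> pair.J \<Longrightarrow> monoid_functional word_value x = 0"
  using pair.words.monoid_functional_vanishes_genideal[OF
      pair.relations_carrier[unfolded free_product_cover_def]] relation_vanish
  unfolding pair.J_eq by (simp add: free_product_cover_def)

lemma tilde_value_linear: "linear_functional (tilde A) tilde_value"
  unfolding tilde_value_def tilde_def free_product_def
  by (rule pair.J.factor_functional_linear)
    (simp_all add: vanish_on_J free_product_cover_def monoid_functional_linear)

lemma tilde_value_word:
  "w \<in> lists letters \<Longrightarrow> tilde_value (pair.word_class w) = word_value w"
  unfolding tilde_value_def pair.word_class_def
  by (subst pair.J.factor_functional_coset)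
    (simp_all add: vanish_on_J free_product_cover_def monoid_functional_linear)

lemma tilde_in_eq: "tilde_in A a = pair.word_class [Inl a]"
  and tilde_p_eq: "tilde_p A = pair.word_class [Inr (0, 1)]"
  by (simp_all add: tilde_in_def tilde_p_def pair.free_product_in_eq)

lemma tilde_in_closed [simp]: "a \<in> carrier A \<Longrightarrow> tilde_in A a \<in> carrier (tilde A)"
  and tilde_p_closed [simp]: "tilde_p A \<in> carrier (tilde A)"
  by (simp_all add: tilde_in_eq tilde_p_eq tilde_def)

lemma tilde_p_idem: "tilde_p A \<otimes>\<^bsub>tilde A\<^esub> tilde_p A = tilde_p A"
  using pair.free_product_in_Inr_mult[of "(0, 1)" "(0, 1)"]
  by (simp add: tilde_p_def tilde_def)

lemma tilde_in_hom:
  assumes "x \<in> carrier A" "y \<in> carrier A"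
  shows "tilde_in A (x \<oplus> y) = tilde_in A x \<oplus>\<^bsub>tilde A\<^esub> tilde_in A y"
    and "tilde_in A (c \<odot> x) = c \<odot>\<^bsub>tilde A\<^esub> tilde_in A x"
    and "tilde_in A (x \<otimes> y) = tilde_in A x \<otimes>\<^bsub>tilde A\<^esub> tilde_in A y"
    and "tilde_in A \<one> = \<one>\<^bsub>tilde A\<^esub>"
  using pair.free_product_in_Inl[OF assms] by (simp_all add: tilde_in_def tilde_def)

section \<open>Values on alternating words\<close>

fun alternating_letters :: "'a list \<Rightarrow> ('a + complex \<times> complex) list" where
  "alternating_letters [] = []"
| "alternating_letters [a] = [Inl a]"
| "alternating_letters (a # b # as) = Inl a # Inr (0, 1) # alternating_letters (b # as)"

lemma alternating_letters_closed:
  "set as \<subseteq> carrier A \<Longrightarrow> alternating_letters as \<in> lists letters"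
  by (induction as rule: alternating_letters.induct) (auto simp del: in_lists_conv_set)

lemma alternating_word_eq:
  "set as \<subseteq> carrier A \<Longrightarrow> alternating_word A as = pair.word_class (alternating_letters as)"
proof (induction as rule: alternating_letters.induct)
  case (3 a b as)
  then show ?case
    using alternating_letters_closed[of "b # as"]
    by (simp add: tilde_in_eq tilde_p_eq tilde_def pair.word_class_mult del: in_lists_conv_set)
qed (simp_all add: pair.word_class_Nil tilde_in_eq tilde_def)

text \<open>From right to left, each p turns the vector built so far into its expectation times the
  unit; only the leftmost letter survives as a vector.\<close>

lemma foldr_alternating:
  "set (a # as) \<subseteq> carrier A \<Longrightarrow>
    foldr act (alternating_letters (a # as)) \<one> = prod_list (map \<phi> as) \<odot> a"
proof (induction as arbitrary: a)
  case (Cons b as)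
  then show ?case
    by (simp add: smult_mult_right mult.commute)
qed simp

text \<open>An outer p is harmless: on the right it fixes the unit, on the left \<phi> applied to
  \<open>\<phi> b \<odot> \<one>\<close> is \<phi> b again. This witness is what gives the choice in
  \<open>tilde_functional\<close> its defining properties.\<close>

lemma tilde_value_spec: "is_tilde_functional A \<phi> tilde_value"
  unfolding is_tilde_functional_def
proof (intro conjI ballI allI impI tilde_value_linear)
  show "tilde_value (tilde_p A) = 1"
    unfolding tilde_p_eq by (subst tilde_value_word) (simp_all add: word_value_def)
next
  fix \<gamma> \<delta> :: nat and as
  assume "\<gamma> \<in> {0, 1}" "\<delta> \<in> {0, 1}" and as: "as \<noteq> [] \<and> set as \<subseteq> carrier A"
  define q where "q k = (if k = 0 then [] else [Inr (0, 1) :: 'a + complex \<times> complex])" for k :: nat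
  have q: "tilde_p A [^]\<^bsub>tilde A\<^esub> k = pair.word_class (q k)" if "k \<in> {0, 1}" for k :: nat
  proof -
    have "tilde_p A [^]\<^bsub>tilde A\<^esub> (1 :: nat) = pair.word_class (q 1)"
      by (simp add: q_def flip: tilde_p_eq)
    moreover have "tilde_p A [^]\<^bsub>tilde A\<^esub> (0 :: nat) = pair.word_class (q 0)"
      by (simp add: q_def pair.word_class_Nil tilde_def)
    ultimately show ?thesis using that by blast
  qed
  have qw: "q k \<in> lists letters" for k by (simp add: q_def)
  obtain a bs where as_eq: "as = a # bs" using as by (cases as) auto
  have one: "foldr act (q k) \<one> = \<one>" for k by (simp add: q_def)
  have phi: "\<phi> (foldr act (q k) b) = \<phi> b" if "b \<in> carrier A" for k b
    using that by (simp add: q_def)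
  have "tilde_value ((tilde_p A [^]\<^bsub>tilde A\<^esub> \<gamma>) \<otimes>\<^bsub>tilde A\<^esub> alternating_word A as
             \<otimes>\<^bsub>tilde A\<^esub> (tilde_p A [^]\<^bsub>tilde A\<^esub> \<delta>))
      = tilde_value (pair.word_class (q \<gamma> @ alternating_letters as @ q \<delta>))"
    using \<open>\<gamma> \<in> {0, 1}\<close> \<open>\<delta> \<in> {0, 1}\<close> as alternating_letters_closed[of as] qw
    by (simp only: q alternating_word_eq) (simp add: tilde_def pair.word_class_mult del: in_lists_conv_set)
  also have "\<dots> = word_value (q \<gamma> @ alternating_letters as @ q \<delta>)"
    using alternating_letters_closed[of as] qw as
    by (intro tilde_value_word) (simp del: in_lists_conv_set)
  also have "\<dots> = prod_list (map \<phi> as)"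
    using as unfolding word_value_def as_eq
    by (simp add: one foldr_alternating phi del: alternating_letters.simps)
  finally show "tilde_value ((tilde_p A [^]\<^bsub>tilde A\<^esub> \<gamma>) \<otimes>\<^bsub>tilde A\<^esub> alternating_word A as
             \<otimes>\<^bsub>tilde A\<^esub> (tilde_p A [^]\<^bsub>tilde A\<^esub> \<delta>)) = prod_list (map \<phi> as)" .
qed

lemma tilde_functional_spec: "is_tilde_functional A \<phi> (tilde_functional A \<phi>)"
  unfolding tilde_functional_def by (rule someI[of _ tilde_value]) (rule tilde_value_spec)

lemma tilde_functional_linear: "linear_functional (tilde A) (tilde_functional A \<phi>)"
  and tilde_functional_p [simp]: "tilde_functional A \<phi> (tilde_p A) = 1"
  and tilde_functional_word: "\<lbrakk>\<gamma> \<in> {0, 1}; \<delta> \<in> {0, 1}; as \<noteq> []; set as \<subseteq> carrier A\<rbrakk> \<Longrightarrow>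
    tilde_functional A \<phi> ((tilde_p A [^]\<^bsub>tilde A\<^esub> (\<gamma> :: nat)) \<otimes>\<^bsub>tilde A\<^esub> alternating_word A as
      \<otimes>\<^bsub>tilde A\<^esub> (tilde_p A [^]\<^bsub>tilde A\<^esub> (\<delta> :: nat))) = prod_list (map \<phi> as)"
  using tilde_functional_spec unfolding is_tilde_functional_def by blast+

section \<open>Normal forms and multiplication from the right\<close>

lemma alternating_word_closed [simp]:
  "set as \<subseteq> carrier A \<Longrightarrow> alternating_word A as \<in> carrier (tilde A)"
  by (induction as rule: alternating_letters.induct) simp_all

text \<open>The recursion of \<open>alternating_word\<close> works at the left end, whereas products
  of replicas are extended at the right end.\<close>

lemma alternating_word_snoc:
  "\<lbrakk>as \<noteq> []; set as \<subseteq> carrier A; b \<in> carrier A\<rbrakk> \<Longrightarrow> alternating_word A (as @ [b])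
    = alternating_word A as \<otimes>\<^bsub>tilde A\<^esub> tilde_p A \<otimes>\<^bsub>tilde A\<^esub> tilde_in A b"
proof (induction as rule: alternating_letters.induct)
  case (3 a b as)
  then show ?case by (simp add: tilde.m_assoc)
qed simp_all

text \<open>The last letter absorbs \<open>b\<close>, as the embedding of \<open>A\<close> is
  multiplicative.\<close>

lemma alternating_word_times_in:
  assumes "as \<noteq> []" "set as \<subseteq> carrier A" "b \<in> carrier A"
  obtains bs where "bs \<noteq> []" "set bs \<subseteq> carrier A"
    "alternating_word A as \<otimes>\<^bsub>tilde A\<^esub> tilde_in A b = alternating_word A bs"
proof -
  obtain xs c where as: "as = xs @ [c]" using assms(1) by (metis rev_exhaust)
  show ?thesis
  proof (rule that[of "xs @ [c \<otimes> b]"])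
    show "alternating_word A as \<otimes>\<^bsub>tilde A\<^esub> tilde_in A b = alternating_word A (xs @ [c \<otimes> b])"
      using assms unfolding as
      by (cases "xs = []") (simp_all add: alternating_word_snoc tilde_in_hom tilde.m_assoc)
  qed (use assms as in auto)
qed

text \<open>Exactly the elements whose value \<open>is_tilde_functional\<close> prescribes. The set
  is stable under right multiplication by p and by elements of \<open>A\<close>, so the entries of
  products built from replicas never leave it.\<close>

definition normal_forms :: "'a tilde set" where
  "normal_forms = insert (tilde_p A)
     {(tilde_p A [^]\<^bsub>tilde A\<^esub> (\<gamma> :: nat)) \<otimes>\<^bsub>tilde A\<^esub> alternating_word A as
        \<otimes>\<^bsub>tilde A\<^esub> (tilde_p A [^]\<^bsub>tilde A\<^esub> (\<delta> :: nat)) | \<gamma> \<delta> as.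
        \<gamma> \<in> {0, 1} \<and> \<delta> \<in> {0, 1} \<and> as \<noteq> [] \<and> set as \<subseteq> carrier A}"

lemma normal_formsI:
  "\<lbrakk>\<gamma> \<in> {0, 1}; \<delta> \<in> {0, 1}; as \<noteq> []; set as \<subseteq> carrier A\<rbrakk> \<Longrightarrow>
    (tilde_p A [^]\<^bsub>tilde A\<^esub> (\<gamma> :: nat)) \<otimes>\<^bsub>tilde A\<^esub> alternating_word A as
      \<otimes>\<^bsub>tilde A\<^esub> (tilde_p A [^]\<^bsub>tilde A\<^esub> (\<delta> :: nat)) \<in> normal_forms"
  unfolding normal_forms_def by blast

lemma normal_forms_cases:
  assumes "x \<in> normal_forms"
  obtains (p) "x = tilde_p A"
    | (open_right) \<gamma> as where "\<gamma> \<in> {0, 1}" "as \<noteq> []" "set as \<subseteq> carrier A"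
      "x = (tilde_p A [^]\<^bsub>tilde A\<^esub> (\<gamma> :: nat)) \<otimes>\<^bsub>tilde A\<^esub> alternating_word A as"
    | (closed_right) \<gamma> as where "\<gamma> \<in> {0, 1}" "as \<noteq> []" "set as \<subseteq> carrier A"
      "x = (tilde_p A [^]\<^bsub>tilde A\<^esub> (\<gamma> :: nat)) \<otimes>\<^bsub>tilde A\<^esub> alternating_word A as
        \<otimes>\<^bsub>tilde A\<^esub> tilde_p A"
proof -
  from assms consider "x = tilde_p A"
    | \<gamma> \<delta> as where "\<gamma> \<in> {0, 1}" "\<delta> \<in> {0, 1}" "as \<noteq> []" "set as \<subseteq> carrier A"
      "x = (tilde_p A [^]\<^bsub>tilde A\<^esub> (\<gamma> :: nat)) \<otimes>\<^bsub>tilde A\<^esub> alternating_word A as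
        \<otimes>\<^bsub>tilde A\<^esub> (tilde_p A [^]\<^bsub>tilde A\<^esub> (\<delta> :: nat))"
    unfolding normal_forms_def by blast
  then show ?thesis
  proof cases
    case (2 \<gamma> \<delta> as)
    show ?thesis
    proof (cases "\<delta> = 0")
      case True
      then show ?thesis using 2 open_right[of \<gamma> as] by simp
    next
      case False
      then have "\<delta> = 1" using 2 by simp
      then show ?thesis using 2 closed_right[of \<gamma> as] by simp
    qed
  qed (rule p)
qed

lemma normal_forms_subset: "normal_forms \<subseteq> carrier (tilde A)"
  unfolding normal_forms_def by auto

lemma tilde_in_normal: "a \<in> carrier A \<Longrightarrow> tilde_in A a \<in> normal_forms"
  using normal_formsI[of 0 0 "[a]"] by simp

lemma one_normal: "\<one>\<^bsub>tilde A\<^esub> \<in> normal_forms"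
  using tilde_in_normal[of \<one>] tilde_in_hom(4)[of \<one> \<one>] by simp

lemma normal_times_p:
  assumes "x \<in> normal_forms"
  shows "x \<otimes>\<^bsub>tilde A\<^esub> tilde_p A \<in> normal_forms"
  using assms
proof (cases rule: normal_forms_cases)
  case (open_right \<gamma> as)
  then show ?thesis using normal_formsI[of \<gamma> 1 as] by simp
next
  case (closed_right \<gamma> as)
  then show ?thesis using normal_formsI[of \<gamma> 1 as] by (simp add: tilde.m_assoc tilde_p_idem)
qed (simp add: tilde_p_idem normal_forms_def)

lemma normal_times_in:
  assumes "x \<in> normal_forms" "b \<in> carrier A"
  shows "x \<otimes>\<^bsub>tilde A\<^esub> tilde_in A b \<in> normal_forms"
  using assms(1)
proof (cases rule: normal_forms_cases)
  case p
  then show ?thesis using normal_formsI[of 1 0 "[b]"] assms by simp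
next
  case (open_right \<gamma> as)
  then obtain bs where "bs \<noteq> []" "set bs \<subseteq> carrier A"
    "alternating_word A as \<otimes>\<^bsub>tilde A\<^esub> tilde_in A b = alternating_word A bs"
    using alternating_word_times_in assms(2) by metis
  then show ?thesis
    using normal_formsI[of \<gamma> 0 bs] open_right assms by (simp add: tilde.m_assoc)
next
  case (closed_right \<gamma> as)
  then show ?thesis
    using normal_formsI[of \<gamma> 0 "as @ [b]"] assms
    by (simp add: tilde.m_assoc alternating_word_snoc)
qed

text \<open>After p p = p has been used, x p b is again a normal form, whose list of letters is that
  of \<open>x\<close> with \<open>b\<close> appended; the product formula splits off \<phi> b. This
  is the precise form in which p replaces b by a number, and with \<phi> b = 0 it makes centred
  entries vanish.\<close>

lemma tilde_functional_p_in:
  assumes "x \<in> normal_forms" "b \<in> carrier A"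
  shows "tilde_functional A \<phi> (x \<otimes>\<^bsub>tilde A\<^esub> tilde_p A \<otimes>\<^bsub>tilde A\<^esub> tilde_in A b)
    = \<phi> b * tilde_functional A \<phi> x"
proof -
  have b: "tilde_in A b \<in> carrier (tilde A)" using assms by simp
  show ?thesis
    using assms(1)
  proof (cases rule: normal_forms_cases)
    case p
    then show ?thesis
      using tilde_functional_word[of 1 0 "[b]"] assms by (simp add: tilde_p_idem)
  next
    case (open_right \<gamma> as)
    then show ?thesis
      using tilde_functional_word[of \<gamma> 0 "as @ [b]"] tilde_functional_word[of \<gamma> 0 as] assms
      by (simp add: tilde.m_assoc alternating_word_snoc)
  next
    case (closed_right \<gamma> as)
    have "tilde_p A \<otimes>\<^bsub>tilde A\<^esub> (tilde_p A \<otimes>\<^bsub>tilde A\<^esub> tilde_in A b) = tilde_p A \<otimes>\<^bsub>tilde A\<^esub> tilde_in A b"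
      using b by (simp add: tilde_p_idem flip: tilde.m_assoc)
    then show ?thesis
      using tilde_functional_word[of \<gamma> 0 "as @ [b]"] tilde_functional_word[of \<gamma> 1 as] assms closed_right
      by (simp add: tilde.m_assoc alternating_word_snoc)
  qed
qed

lemma tilde_functional_times_p:
  "x \<in> normal_forms \<Longrightarrow> tilde_functional A \<phi> (x \<otimes>\<^bsub>tilde A\<^esub> tilde_p A) = tilde_functional A \<phi> x"
  using tilde_functional_p_in[of x \<one>] tilde_in_hom(4)[of \<one> \<one>] normal_forms_subset
  by (simp add: subset_iff)

lemma tilde_functional_in: "b \<in> carrier A \<Longrightarrow> tilde_functional A \<phi> (tilde_in A b) = \<phi> b"
  using tilde_functional_word[of 0 0 "[b]"] by simp

lemma tilde_functional_one [simp]: "tilde_functional A \<phi> \<one>\<^bsub>tilde A\<^esub> = 1"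
  using tilde_functional_in[of \<one>] tilde_in_hom(4)[of \<one> \<one>] by simp

end

section \<open>The functional on the tensor product\<close>

locale nc_family =
  fixes I :: "'i set" and A :: "'i \<Rightarrow> (complex, 'a) module" and \<phi> :: "'i \<Rightarrow> 'a \<Rightarrow> complex"
  assumes space: "l \<in> I \<Longrightarrow> nc_probability_space (A l) (\<phi> l)"
begin

abbreviation site_algebra :: "'i \<times> nat \<Rightarrow> (complex, 'a tilde) module" where
  "site_algebra s \<equiv> tilde (A (fst s))"

abbreviation site_value :: "'i \<times> nat \<Rightarrow> 'a tilde \<Rightarrow> complex" where
  "site_value s \<equiv> tilde_functional (A (fst s)) (\<phi> (fst s))"

lemma site_space: "s \<in> sites I \<Longrightarrow> nc_probability_space (A (fst s)) (\<phi> (fst s))"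
  by (auto simp: sites_def intro: space)

lemma site_complex_algebra: "s \<in> sites I \<Longrightarrow> complex_algebra (site_algebra s)"
proof -
  assume "s \<in> sites I"
  then interpret nc_probability_space "A (fst s)" "\<phi> (fst s)" by (rule site_space)
  show ?thesis by (rule tilde.complex_algebra_axioms)
qed

lemma site_ring: "s \<in> sites I \<Longrightarrow> ring (site_algebra s)"
  using site_complex_algebra complex_algebra.axioms(2) by blast

lemma site_monoid: "s \<in> sites I \<Longrightarrow> Group.monoid (site_algebra s)"
  using site_ring ring.is_monoid by blast

lemma site_add_closed:
  "\<lbrakk>s \<in> sites I; u \<in> carrier (site_algebra s); v \<in> carrier (site_algebra s)\<rbrakk> \<Longrightarrow>
    u \<oplus>\<^bsub>site_algebra s\<^esub> v \<in> carrier (site_algebra s)"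
proof -
  assume s: "s \<in> sites I" and uv: "u \<in> carrier (site_algebra s)" "v \<in> carrier (site_algebra s)"
  interpret S: complex_algebra "site_algebra s" using s by (rule site_complex_algebra)
  show ?thesis using uv by simp
qed

lemma site_smult_closed:
  "\<lbrakk>s \<in> sites I; u \<in> carrier (site_algebra s)\<rbrakk> \<Longrightarrow> c \<odot>\<^bsub>site_algebra s\<^esub> u \<in> carrier (site_algebra s)"
proof -
  assume s: "s \<in> sites I" and u: "u \<in> carrier (site_algebra s)"
  interpret S: complex_algebra "site_algebra s" using s by (rule site_complex_algebra)
  show ?thesis using u by simp
qed

lemma entry_families_carrier:
  "\<lbrakk>x \<in> entry_families I A; s \<in> sites I\<rbrakk> \<Longrightarrow> x s \<in> carrier (site_algebra s)"
  by (auto simp: entry_families_def)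

lemma entry_families_ext: "\<lbrakk>x \<in> entry_families I A; s \<notin> sites I\<rbrakk> \<Longrightarrow> x s = undefined"
  by (auto simp: entry_families_def)

lemma entry_families_finite:
  "x \<in> entry_families I A \<Longrightarrow>
    finite {s \<in> sites I. x s \<notin> {\<one>\<^bsub>site_algebra s\<^esub>, tilde_p (A (fst s))}}"
  by (auto simp: entry_families_def)

lemma entry_monoid_simps [simp]:
  "carrier (entry_monoid I A) = entry_families I A"
  "x \<otimes>\<^bsub>entry_monoid I A\<^esub> y = (\<lambda>s\<in>sites I. x s \<otimes>\<^bsub>site_algebra s\<^esub> y s)"
  "\<one>\<^bsub>entry_monoid I A\<^esub> = (\<lambda>s\<in>sites I. \<one>\<^bsub>site_algebra s\<^esub>)"
  by (simp_all add: entry_monoid_def)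

text \<open>Idempotence of p keeps the pair of default entries closed under multiplication, so a
  product of two families is exceptional only where one of the factors is.\<close>

lemma site_unit_p:
  assumes "s \<in> sites I"
    "u \<in> {\<one>\<^bsub>site_algebra s\<^esub>, tilde_p (A (fst s))}" "v \<in> {\<one>\<^bsub>site_algebra s\<^esub>, tilde_p (A (fst s))}"
  shows "u \<otimes>\<^bsub>site_algebra s\<^esub> v \<in> {\<one>\<^bsub>site_algebra s\<^esub>, tilde_p (A (fst s))}"
proof -
  interpret nc_probability_space "A (fst s)" "\<phi> (fst s)" using assms(1) by (rule site_space)
  show ?thesis using assms(2,3) tilde_p_closed by (elim insertE emptyE) (simp_all add: tilde_p_idem)
qed

lemma entry_mult_closed:
  assumes "x \<in> entry_families I A" "y \<in> entry_families I A"
  shows "(\<lambda>s\<in>sites I. x s \<otimes>\<^bsub>site_algebra s\<^esub> y s) \<in> entry_families I A"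
proof -
  have "finite ({s \<in> sites I. x s \<notin> {\<one>\<^bsub>site_algebra s\<^esub>, tilde_p (A (fst s))}} \<union>
      {s \<in> sites I. y s \<notin> {\<one>\<^bsub>site_algebra s\<^esub>, tilde_p (A (fst s))}})" (is "finite ?S")
    using assms entry_families_finite by blast
  then have "finite {s \<in> sites I. x s \<otimes>\<^bsub>site_algebra s\<^esub> y s
      \<notin> {\<one>\<^bsub>site_algebra s\<^esub>, tilde_p (A (fst s))}}"
    by (rule finite_subset[rotated]) (use site_unit_p in blast)
  moreover have "x s \<otimes>\<^bsub>site_algebra s\<^esub> y s \<in> carrier (site_algebra s)" if "s \<in> sites I" for s
    using that assms entry_families_carrier Group.monoid.m_closed[OF site_monoid] by blast
  ultimately show ?thesis
    unfolding entry_families_def by (auto cong: conj_cong)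
qed

lemma entry_one_closed: "(\<lambda>s\<in>sites I. \<one>\<^bsub>site_algebra s\<^esub>) \<in> entry_families I A"
  using Group.monoid.one_closed[OF site_monoid] by (auto simp: entry_families_def)

lemma entry_upd_closed:
  assumes "x \<in> entry_families I A" "s \<in> sites I" "u \<in> carrier (site_algebra s)"
  shows "x(s := u) \<in> entry_families I A"
proof -
  have "finite (insert s {s \<in> sites I. x s \<notin> {\<one>\<^bsub>site_algebra s\<^esub>, tilde_p (A (fst s))}})"
    using entry_families_finite[OF assms(1)] by simp
  then have "finite {t \<in> sites I. (x(s := u)) t \<notin> {\<one>\<^bsub>site_algebra t\<^esub>, tilde_p (A (fst t))}}"
    by (rule finite_subset[rotated]) (auto split: if_splits)
  then show ?thesis
    using assms unfolding entry_families_def by (auto simp: PiE_iff extensional_def)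
qed

sublocale entry: plain_monoid "entry_monoid I A"
  unfolding plain_monoid_def
proof (rule monoidI)
  fix x y z
  assume "x \<in> carrier (entry_monoid I A)" "y \<in> carrier (entry_monoid I A)" "z \<in> carrier (entry_monoid I A)"
  then show "x \<otimes>\<^bsub>entry_monoid I A\<^esub> y \<otimes>\<^bsub>entry_monoid I A\<^esub> z
      = x \<otimes>\<^bsub>entry_monoid I A\<^esub> (y \<otimes>\<^bsub>entry_monoid I A\<^esub> z)"
    by (simp, intro restrict_ext) (simp add: entry_families_carrier Group.monoid.m_assoc[OF site_monoid])
next
  fix x assume x: "x \<in> carrier (entry_monoid I A)"
  show "\<one>\<^bsub>entry_monoid I A\<^esub> \<otimes>\<^bsub>entry_monoid I A\<^esub> x = x"
  proof (rule ext)
    fix s show "(\<one>\<^bsub>entry_monoid I A\<^esub> \<otimes>\<^bsub>entry_monoid I A\<^esub> x) s = x s"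
      using x by (cases "s \<in> sites I")
        (simp_all add: entry_families_carrier entry_families_ext Group.monoid.l_one[OF site_monoid])
  qed
  show "x \<otimes>\<^bsub>entry_monoid I A\<^esub> \<one>\<^bsub>entry_monoid I A\<^esub> = x"
  proof (rule ext)
    fix s show "(x \<otimes>\<^bsub>entry_monoid I A\<^esub> \<one>\<^bsub>entry_monoid I A\<^esub>) s = x s"
      using x by (cases "s \<in> sites I")
        (simp_all add: entry_families_carrier entry_families_ext Group.monoid.r_one[OF site_monoid])
  qed
qed (simp_all add: entry_mult_closed entry_one_closed)

abbreviation F where "F \<equiv> tensor_cover I A"
abbreviation J where "J \<equiv> tensor_ideal I A"
abbreviation st where "st \<equiv> simple_tensor I A"

sublocale F: complex_algebra F
  unfolding tensor_cover_def by (rule entry.monoid_algebra_complex_algebra)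

lemma single_in_cover: "x \<in> entry_families I A \<Longrightarrow> Poly_Mapping.single x c \<in> carrier F"
  by (simp add: tensor_cover_def)

lemma relations_carrier: "multilinear_relations I A \<subseteq> carrier F"
  unfolding multilinear_relations_def Let_def
  by (auto intro!: F.minus_closed F.add.m_closed F.smult_closed single_in_cover entry_upd_closed
      site_add_closed[of "(l, k)" for l k, simplified] site_smult_closed[of "(l, k)" for l k, simplified])

sublocale J: algebra_ideal F J
  unfolding tensor_ideal_def by (rule F.algebra_ideal_genideal[OF relations_carrier])

sublocale T: complex_algebra "tensor_algebra I A"
  unfolding tensor_algebra_def by (rule J.quotient_complex_algebra)

section \<open>The product of the site values as a multilinear form\<close>

definition family_value :: "('i \<times> nat \<Rightarrow> 'a tilde) \<Rightarrow> complex" where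
  "family_value x = (\<Prod>s\<in>{s \<in> sites I. site_value s (x s) \<noteq> 1}. site_value s (x s))"

lemma site_value_unit_p:
  "\<lbrakk>s \<in> sites I; u \<in> {\<one>\<^bsub>site_algebra s\<^esub>, tilde_p (A (fst s))}\<rbrakk> \<Longrightarrow> site_value s u = 1"
proof -
  assume "s \<in> sites I" and u: "u \<in> {\<one>\<^bsub>site_algebra s\<^esub>, tilde_p (A (fst s))}"
  then interpret nc_probability_space "A (fst s)" "\<phi> (fst s)" by (intro site_space)
  show ?thesis using u by auto
qed

lemma finite_value_support:
  "x \<in> entry_families I A \<Longrightarrow> finite {s \<in> sites I. site_value s (x s) \<noteq> 1}"
  by (rule finite_subset[OF _ entry_families_finite[of x]]) (use site_value_unit_p in blast)+

text \<open>The index set of \<open>family_value\<close> depends on whether \<open>u\<close> has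
  value 1. Enlarging it by \<open>s\<close> makes it independent of \<open>u\<close>, and the
  dependence on the entry at \<open>s\<close> becomes visibly linear.\<close>

lemma family_value_upd:
  assumes x: "x \<in> entry_families I A" and s: "s \<in> sites I"
  shows "family_value (x(s := u)) = site_value s u *
    (\<Prod>t\<in>{t \<in> sites I. site_value t (x t) \<noteq> 1} - {s}. site_value t (x t))"
proof -
  let ?S = "{t \<in> sites I. site_value t (x t) \<noteq> 1} - {s}"
  have fin: "finite ?S" using finite_value_support[OF x] by simp
  have "family_value (x(s := u)) = (\<Prod>t\<in>insert s ?S. site_value t ((x(s := u)) t))"
    unfolding family_value_def
    by (rule prod.mono_neutral_left) (use fin s in \<open>auto split: if_splits\<close>)
  also have "\<dots> = site_value s u * (\<Prod>t\<in>?S. site_value t ((x(s := u)) t))"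
    using fin by (subst prod.insert) auto
  also have "(\<Prod>t\<in>?S. site_value t ((x(s := u)) t)) = (\<Prod>t\<in>?S. site_value t (x t))"
    by (rule prod.cong) auto
  finally show ?thesis .
qed

lemma site_value_linear: "s \<in> sites I \<Longrightarrow> linear_functional (site_algebra s) (site_value s)"
proof -
  assume "s \<in> sites I"
  then interpret nc_probability_space "A (fst s)" "\<phi> (fst s)" by (rule site_space)
  show ?thesis by (rule tilde_functional_linear)
qed

lemma family_value_upd_add:
  assumes "x \<in> entry_families I A" "s \<in> sites I" "u \<in> carrier (site_algebra s)" "v \<in> carrier (site_algebra s)"
  shows "family_value (x(s := u \<oplus>\<^bsub>site_algebra s\<^esub> v)) = family_value (x(s := u)) + family_value (x(s := v))"
  using site_value_linear[OF assms(2)] assms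
  by (simp add: family_value_upd linear_functional_def distrib_right)

lemma family_value_upd_smult:
  assumes "x \<in> entry_families I A" "s \<in> sites I" "u \<in> carrier (site_algebra s)"
  shows "family_value (x(s := c \<odot>\<^bsub>site_algebra s\<^esub> u)) = c * family_value (x(s := u))"
  using site_value_linear[OF assms(2)] assms
  by (simp add: family_value_upd linear_functional_def)

lemma entry_mult_upd:
  assumes "s \<in> sites I"
  shows "y \<otimes>\<^bsub>entry_monoid I A\<^esub> x(s := u) \<otimes>\<^bsub>entry_monoid I A\<^esub> z
    = (y \<otimes>\<^bsub>entry_monoid I A\<^esub> x \<otimes>\<^bsub>entry_monoid I A\<^esub> z)
        (s := y s \<otimes>\<^bsub>site_algebra s\<^esub> u \<otimes>\<^bsub>site_algebra s\<^esub> z s)"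
  using assms by (intro ext) simp

text \<open>Multiplication is sitewise, so the outer factors \<open>y\<close> and \<open>z\<close>
  turn a relation at site \<open>s\<close> into one at the same site, with \<open>y s\<close> and
  \<open>z s\<close> absorbed into the entry. Linearity of \<open>family_value\<close> in that entry
  finishes the argument.\<close>

lemma relation_vanish:
  assumes y: "y \<in> entry_families I A" and z: "z \<in> entry_families I A"
    and r: "r \<in> multilinear_relations I A"
  shows "monoid_functional family_value
    (Poly_Mapping.single y 1 \<otimes>\<^bsub>F\<^esub> r \<otimes>\<^bsub>F\<^esub> Poly_Mapping.single z 1) = 0"
proof -
  let ?yz = "\<lambda>x. y \<otimes>\<^bsub>entry_monoid I A\<^esub> x \<otimes>\<^bsub>entry_monoid I A\<^esub> z"
  have fam: "?yz x \<in> entry_families I A" if "x \<in> entry_families I A" for x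
    using entry.m_closed y z that unfolding entry_monoid_simps(1) by blast
  note expand = tensor_cover_def monoid_algebra_distribs monoid_algebra_mult_diff
    monoid_functional_diff monoid_functional_add
  from r consider
    (add) x s u v where "x \<in> entry_families I A" "s \<in> sites I"
        "u \<in> carrier (site_algebra s)" "v \<in> carrier (site_algebra s)"
        "r = Poly_Mapping.single (x(s := u \<oplus>\<^bsub>site_algebra s\<^esub> v)) 1
          \<ominus>\<^bsub>F\<^esub> (Poly_Mapping.single (x(s := u)) 1 \<oplus>\<^bsub>F\<^esub> Poly_Mapping.single (x(s := v)) 1)"
    | (smult) x s c u where "x \<in> entry_families I A" "s \<in> sites I" "u \<in> carrier (site_algebra s)"
        "r = Poly_Mapping.single (x(s := c \<odot>\<^bsub>site_algebra s\<^esub> u)) 1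
          \<ominus>\<^bsub>F\<^esub> c \<odot>\<^bsub>F\<^esub> Poly_Mapping.single (x(s := u)) 1"
    unfolding multilinear_relations_def Let_def by blast
  then show ?thesis
  proof cases
    case add
    interpret S: complex_algebra "site_algebra s" using add(2) by (rule site_complex_algebra)
    have ys: "y s \<in> carrier (site_algebra s)" "z s \<in> carrier (site_algebra s)"
      using y z add(2) by (simp_all add: entry_families_carrier)
    have "r = Poly_Mapping.single (x(s := u \<oplus>\<^bsub>site_algebra s\<^esub> v)) 1
        - (Poly_Mapping.single (x(s := u)) 1 + Poly_Mapping.single (x(s := v)) 1)"
      unfolding add(5) tensor_cover_def using add(1-4)
      by (subst entry.monoid_algebra_minus)
        (simp_all add: entry_upd_closed keys_plus_subset)
    then have "monoid_functional family_value
        (Poly_Mapping.single y 1 \<otimes>\<^bsub>F\<^esub> r \<otimes>\<^bsub>F\<^esub> Poly_Mapping.single z 1)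
      = family_value (?yz (x(s := u \<oplus>\<^bsub>site_algebra s\<^esub> v))) - (family_value (?yz (x(s := u))) + family_value (?yz (x(s := v))))"
      by (simp add: expand del: entry_monoid_simps)
    also have "\<dots> = 0"
      using add(1-4) ys fam[OF add(1)]
      by (simp add: entry_mult_upd S.r_distr S.l_distr family_value_upd_add del: entry_monoid_simps)
    finally show ?thesis .
  next
    case smult
    interpret S: complex_algebra "site_algebra s" using smult(2) by (rule site_complex_algebra)
    have ys: "y s \<in> carrier (site_algebra s)" "z s \<in> carrier (site_algebra s)"
      using y z smult(2) by (simp_all add: entry_families_carrier)
    have "r = Poly_Mapping.single (x(s := c \<odot>\<^bsub>site_algebra s\<^esub> u)) 1
        - Poly_Mapping.single (x(s := u)) c"
      unfolding smult(4) tensor_cover_def using smult(1-3)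
      by (subst entry.monoid_algebra_minus) (simp_all add: entry_upd_closed)
    then have "monoid_functional family_value
        (Poly_Mapping.single y 1 \<otimes>\<^bsub>F\<^esub> r \<otimes>\<^bsub>F\<^esub> Poly_Mapping.single z 1)
      = family_value (?yz (x(s := c \<odot>\<^bsub>site_algebra s\<^esub> u))) - c * family_value (?yz (x(s := u)))"
      by (simp add: expand del: entry_monoid_simps)
    also have "\<dots> = 0"
      using smult(1-3) ys fam[OF smult(1)]
      by (simp add: entry_mult_upd S.smult_mult_left S.smult_mult_right family_value_upd_smult
          del: entry_monoid_simps)
    finally show ?thesis .
  qed
qed

lemma vanish_on_J: "x \<in> J \<Longrightarrow> monoid_functional family_value x = 0"
  using entry.monoid_functional_vanishes_genideal[OF
      relations_carrier[unfolded tensor_cover_def]] relation_vanish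
  unfolding tensor_ideal_def by (simp add: tensor_cover_def)

text \<open>Linear extension of \<open>family_value\<close>, passed to the quotient, is the witness
  that makes the choice in \<open>tensor_functional\<close> effective.\<close>

lemma tensor_functional_spec: "is_tensor_functional I A \<phi> (tensor_functional I A \<phi>)"
  unfolding tensor_functional_def
proof (rule someI[of _ "J.factor_functional (monoid_functional family_value)"])
  have lin: "linear_functional F (monoid_functional family_value)"
    unfolding tensor_cover_def by (rule monoid_functional_linear)
  show "is_tensor_functional I A \<phi> (J.factor_functional (monoid_functional family_value))"
    unfolding is_tensor_functional_def
  proof (intro conjI ballI)
    show "linear_functional (tensor_algebra I A) (J.factor_functional (monoid_functional family_value))"
      unfolding tensor_algebra_def by (rule J.factor_functional_linear[OF lin vanish_on_J])
    fix x assume "x \<in> entry_families I A"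
    then show "J.factor_functional (monoid_functional family_value) (st x)
        = (\<Prod>s\<in>{s \<in> sites I. site_value s (x s) \<noteq> 1}. site_value s (x s))"
      unfolding simple_tensor_def
      by (subst J.factor_functional_coset[OF lin vanish_on_J])
        (simp_all add: single_in_cover family_value_def)
  qed
qed

abbreviation \<Phi> where "\<Phi> \<equiv> tensor_functional I A \<phi>"

lemma \<Phi>_linear: "linear_functional (tensor_algebra I A) \<Phi>"
  and \<Phi>_simple_tensor: "x \<in> entry_families I A \<Longrightarrow> \<Phi> (st x) = family_value x"
  using tensor_functional_spec by (simp_all add: is_tensor_functional_def family_value_def)

lemma simple_tensor_closed [simp]: "x \<in> entry_families I A \<Longrightarrow> st x \<in> carrier (tensor_algebra I A)"
  unfolding simple_tensor_def tensor_algebra_def by (simp add: single_in_cover)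

lemma simple_tensor_mult:
  assumes "x \<in> entry_families I A" "y \<in> entry_families I A"
  shows "st x \<otimes>\<^bsub>tensor_algebra I A\<^esub> st y = st (x \<otimes>\<^bsub>entry_monoid I A\<^esub> y)"
  unfolding simple_tensor_def tensor_algebra_def
  using assms by (subst J.quotient_mult) (simp_all add: single_in_cover tensor_cover_def)

lemma simple_tensor_one: "st \<one>\<^bsub>entry_monoid I A\<^esub> = \<one>\<^bsub>tensor_algebra I A\<^esub>"
  unfolding simple_tensor_def tensor_algebra_def J.quotient_one by (simp add: tensor_cover_def)

section \<open>Stacks\<close>

abbreviation entry_mult (infixl \<open>\<bullet>\<close> 70) where "x \<bullet> y \<equiv> x \<otimes>\<^bsub>entry_monoid I A\<^esub> y"

lemma entry_mult_at: "s \<in> sites I \<Longrightarrow> (x \<bullet> y) s = x s \<otimes>\<^bsub>site_algebra s\<^esub> y s"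
  by simp

declare entry_monoid_simps(2,3) [simp del]

text \<open>The families allowed to the left of a stack: at each site the rules for x p and x p b
  under the functional apply.\<close>

definition good_families :: "('i \<times> nat \<Rightarrow> 'a tilde) set" where
  "good_families = {x \<in> entry_families I A.
     \<forall>s\<in>sites I. x s \<in> nc_probability_space.normal_forms (A (fst s))}"

text \<open>The entries of \<open>P\<^sub>i(j)\<close> for j at least 1. Truncated subtraction makes
  \<open>P_family i 0\<close> equal to \<open>P_family i 1\<close>, whereas
  \<open>P\<^sub>i(0)\<close> is zero; hence the separate case j = 1 wherever
  \<open>P_family i (j - 1)\<close> is subtracted.\<close>

definition P_family :: "'i \<Rightarrow> nat \<Rightarrow> 'i \<times> nat \<Rightarrow> 'a tilde" where
  "P_family i j = (\<lambda>(k, m)\<in>sites I. if k = i \<or> m \<le> j - 1 then \<one>\<^bsub>tilde (A k)\<^esub> else tilde_p (A k))"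

definition iota_family :: "'i \<Rightarrow> nat \<Rightarrow> 'a \<Rightarrow> 'i \<times> nat \<Rightarrow> 'a tilde" where
  "iota_family i j a = (\<lambda>(k, m)\<in>sites I. if (k, m) = (i, j) then tilde_in (A k) a else \<one>\<^bsub>tilde (A k)\<^esub>)"

lemma P_family_at: "s \<in> sites I \<Longrightarrow> P_family i j s =
    (if fst s = i \<or> snd s \<le> j - 1 then \<one>\<^bsub>site_algebra s\<^esub> else tilde_p (A (fst s)))"
  by (simp add: P_family_def split: prod.split)

lemma iota_family_at: "s \<in> sites I \<Longrightarrow> iota_family i j a s =
    (if s = (i, j) then tilde_in (A (fst s)) a else \<one>\<^bsub>site_algebra s\<^esub>)"
  by (simp add: iota_family_def split: prod.split)

lemma site_closed:
  assumes "s \<in> sites I"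
  shows "\<one>\<^bsub>site_algebra s\<^esub> \<in> carrier (site_algebra s)"
    and "tilde_p (A (fst s)) \<in> carrier (site_algebra s)"
    and "a \<in> carrier (A (fst s)) \<Longrightarrow> tilde_in (A (fst s)) a \<in> carrier (site_algebra s)"
proof -
  interpret nc_probability_space "A (fst s)" "\<phi> (fst s)" using assms by (rule site_space)
  show "\<one>\<^bsub>site_algebra s\<^esub> \<in> carrier (site_algebra s)"
    and "tilde_p (A (fst s)) \<in> carrier (site_algebra s)"
    and "a \<in> carrier (A (fst s)) \<Longrightarrow> tilde_in (A (fst s)) a \<in> carrier (site_algebra s)"
    by simp_all
qed

lemma P_family_closed: "P_family i j \<in> entry_families I A"
proof -
  have "{s \<in> sites I. P_family i j s \<notin> {\<one>\<^bsub>site_algebra s\<^esub>, tilde_p (A (fst s))}} = {}"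
    using P_family_at by force
  moreover have "P_family i j \<in> (\<Pi>\<^sub>E s\<in>sites I. carrier (site_algebra s))"
  proof (rule PiE_I)
    fix s assume "s \<in> sites I"
    then show "P_family i j s \<in> carrier (site_algebra s)" by (simp add: P_family_at site_closed)
  qed (simp add: P_family_def)
  ultimately show ?thesis unfolding entry_families_def by (simp only: mem_Collect_eq finite.emptyI)
qed

lemma iota_family_eq:
  "(i, j) \<in> sites I \<Longrightarrow> iota_family i j a = \<one>\<^bsub>entry_monoid I A\<^esub>((i, j) := tilde_in (A i) a)"
proof (rule ext)
  fix s assume "(i, j) \<in> sites I"
  then show "iota_family i j a s = (\<one>\<^bsub>entry_monoid I A\<^esub>((i, j) := tilde_in (A i) a)) s"
  proof (cases "s \<in> sites I")
    case False
    moreover from this have "s \<noteq> (i, j)" using \<open>(i, j) \<in> sites I\<close> by blast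
    ultimately show ?thesis by (simp add: iota_family_def entry_monoid_simps)
  qed (simp add: iota_family_at entry_monoid_simps)
qed

lemma iota_family_closed:
  assumes "(i, j) \<in> sites I" "a \<in> carrier (A i)"
  shows "iota_family i j a \<in> entry_families I A"
  using assms entry.one_closed site_closed(3)[of "(i, j)" a]
  by (simp add: iota_family_eq entry_upd_closed)

lemma good_entry: "x \<in> good_families \<Longrightarrow> x \<in> entry_families I A"
  by (simp add: good_families_def)

lemma good_form:
  "\<lbrakk>x \<in> good_families; s \<in> sites I\<rbrakk> \<Longrightarrow> x s \<in> nc_probability_space.normal_forms (A (fst s))"
  by (simp add: good_families_def)

lemma good_one: "\<one>\<^bsub>entry_monoid I A\<^esub> \<in> good_families"
  using entry.one_closed nc_probability_space.one_normal[OF site_space]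
  by (auto simp: good_families_def entry_monoid_simps)

lemma good_times_P:
  assumes "x \<in> good_families"
  shows "x \<bullet> P_family i j \<in> good_families"
proof -
  have "(x \<bullet> P_family i j) s \<in> nc_probability_space.normal_forms (A (fst s))" if s: "s \<in> sites I" for s
  proof -
    interpret nc_probability_space "A (fst s)" "\<phi> (fst s)" using s by (rule site_space)
    show ?thesis
      using good_form[OF assms s] normal_forms_subset normal_times_p[of "x s"]
      by (auto simp: entry_mult_at[OF s] P_family_at[OF s])
  qed
  then show ?thesis
    using assms P_family_closed entry.m_closed by (simp add: good_families_def)
qed

lemma good_times_iota:
  assumes "x \<in> good_families" "(i, j) \<in> sites I" "a \<in> carrier (A i)"
  shows "x \<bullet> iota_family i j a \<in> good_families"
proof -
  have "(x \<bullet> iota_family i j a) s \<in> nc_probability_space.normal_forms (A (fst s))" if s: "s \<in> sites I" for s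
  proof -
    interpret nc_probability_space "A (fst s)" "\<phi> (fst s)" using s by (rule site_space)
    show ?thesis
      using good_form[OF assms(1) s] normal_forms_subset normal_times_in[of "x s"] assms(3)
      by (auto simp: entry_mult_at[OF s] iota_family_at[OF s])
  qed
  then show ?thesis
    using assms iota_family_closed entry.m_closed by (simp add: good_families_def)
qed

lemma family_value_cong:
  assumes "\<And>s. s \<in> sites I \<Longrightarrow> site_value s (x s) = site_value s (y s)"
  shows "family_value x = family_value y"
  unfolding family_value_def by (rule prod.cong) (use assms in auto)

lemma family_value_zero:
  assumes "x \<in> entry_families I A" "s \<in> sites I" "site_value s (x s) = 0"
  shows "family_value x = 0"
  unfolding family_value_def using finite_value_support[OF assms(1)] assms(2,3)
  by (intro prod_zero bexI[of _ s]) simp_all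

text \<open>A stack \<open>(i\<^sub>r, b\<^sub>r), \<dots>, (i\<^sub>1, b\<^sub>1)\<close> stands for the vector \<open>b\<^sub>1 \<otimes> \<dots> \<otimes> b\<^sub>r\<close> of a free
  Fock space, with \<open>b\<^sub>m\<close> placed at site \<open>(i\<^sub>m, m)\<close>.\<close>

fun stack_family :: "('i \<times> 'a) list \<Rightarrow> 'i \<times> nat \<Rightarrow> 'a tilde" where
  "stack_family [] = \<one>\<^bsub>entry_monoid I A\<^esub>"
| "stack_family ((i, b) # v) = (stack_family v)((i, Suc (length v)) := tilde_in (A i) b)"

fun valid_stack :: "('i \<times> 'a) list \<Rightarrow> bool" where
  "valid_stack [] \<longleftrightarrow> True"
| "valid_stack ((i, b) # v) \<longleftrightarrow> i \<in> I \<and> b \<in> carrier (A i) \<and> \<phi> i b = 0 \<and>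
     (v = [] \<or> fst (hd v) \<noteq> i) \<and> valid_stack v"

lemma site_iff: "(i, j) \<in> sites I \<longleftrightarrow> i \<in> I \<and> 1 \<le> j"
  by (auto simp: sites_def)

lemma stack_family_Cons_closed:
  assumes "stack_family v \<in> entry_families I A" "i \<in> I" "b \<in> carrier (A i)"
  shows "stack_family ((i, b) # v) \<in> entry_families I A"
  using assms site_closed(3)[of "(i, Suc (length v))" b]
  by (simp add: entry_upd_closed site_iff)

lemma stack_family_closed: "valid_stack v \<Longrightarrow> stack_family v \<in> entry_families I A"
proof (induction v rule: valid_stack.induct)
  case 1
  then show ?case using entry.one_closed by simp
next
  case (2 i b v)
  then show ?case by (intro stack_family_Cons_closed) simp_all
qed

lemma stack_family_above:
  "\<lbrakk>s \<in> sites I; snd s > length v\<rbrakk> \<Longrightarrow> stack_family v s = \<one>\<^bsub>site_algebra s\<^esub>"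
  by (induction v rule: stack_family.induct) (auto simp: entry_monoid_simps)

lemma stack_family_beside_top:
  "\<lbrakk>s \<in> sites I; snd s = length v; v = [] \<or> fst (hd v) \<noteq> fst s\<rbrakk> \<Longrightarrow> stack_family v s = \<one>\<^bsub>site_algebra s\<^esub>"
  by (cases v rule: stack_family.cases) (auto simp: entry_monoid_simps(3) stack_family_above)

section \<open>The projections on stacks\<close>

text \<open>For a valid stack and j at least 1 this says that no entry sits at a site where
  \<open>P_family i j\<close> has p, that is, at a level at least j with a label other than i.
  Alternation of labels reduces the condition to the length and the top label.\<close>

definition compatible :: "'i \<Rightarrow> nat \<Rightarrow> ('i \<times> 'a) list \<Rightarrow> bool" where
  "compatible i j v \<longleftrightarrow> length v < j \<or> (length v = j \<and> v \<noteq> [] \<and> fst (hd v) = i)"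

text \<open>Wherever the projection has p the stack has the unit, and a p at the right end of a
  normal form does not change its value. The two families themselves differ; only their values
  agree.\<close>

lemma P_family_absorb:
  assumes x: "x \<in> good_families" and v: "valid_stack v" and comp: "compatible i j v" and j: "1 \<le> j"
  shows "family_value (x \<bullet> P_family i j \<bullet> stack_family v) = family_value (x \<bullet> stack_family v)"
proof (rule family_value_cong)
  fix s assume s: "s \<in> sites I"
  interpret nc_probability_space "A (fst s)" "\<phi> (fst s)" using s by (rule site_space)
  have xs: "x s \<in> normal_forms" "x s \<in> carrier (site_algebra s)"
    using good_form[OF x s] normal_forms_subset by auto
  show "site_value s ((x \<bullet> P_family i j \<bullet> stack_family v) s) = site_value s ((x \<bullet> stack_family v) s)"
  proof (cases "fst s = i \<or> snd s \<le> j - 1")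
    case True
    then show ?thesis using xs by (simp add: entry_mult_at[OF s] P_family_at[OF s])
  next
    case False
    have "stack_family v s = \<one>\<^bsub>site_algebra s\<^esub>"
    proof (cases "length v < snd s")
      case True
      then show ?thesis by (rule stack_family_above[OF s])
    next
      case leq: False
      show ?thesis
        by (rule stack_family_beside_top[OF s]) (use False leq comp in \<open>auto simp: compatible_def\<close>)
    qed
    then show ?thesis
      using xs False by (simp add: entry_mult_at[OF s] P_family_at[OF s] tilde_functional_times_p)
  qed
qed

text \<open>At \<open>s\<close> the entry is a normal form times p times a centred \<open>b\<close>,
  so its value is a multiple of \<phi> b = 0, and one zero factor annihilates the product over all
  sites.\<close>

lemma P_family_kill_at:
  assumes x: "x \<in> good_families" and v: "valid_stack v" and s: "s \<in> sites I"
    and ps: "fst s \<noteq> i" "j \<le> snd s" "1 \<le> j"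
    and b: "stack_family v s = tilde_in (A (fst s)) b" "b \<in> carrier (A (fst s))" "\<phi> (fst s) b = 0"
  shows "family_value (x \<bullet> P_family i j \<bullet> stack_family v) = 0"
proof (rule family_value_zero[OF _ s])
  show "x \<bullet> P_family i j \<bullet> stack_family v \<in> entry_families I A"
    using good_entry[OF x] P_family_closed stack_family_closed[OF v] entry.m_closed by simp
  interpret nc_probability_space "A (fst s)" "\<phi> (fst s)" using s by (rule site_space)
  show "site_value s ((x \<bullet> P_family i j \<bullet> stack_family v) s) = 0"
  proof -
    have "\<not> snd s \<le> j - 1" using ps by linarith
    then show ?thesis
      using tilde_functional_p_in[OF good_form[OF x s] b(2)] ps b
      by (simp add: entry_mult_at[OF s] P_family_at[OF s])
  qed
qed

text \<open>Neighbouring levels of a stack have different labels, so an incompatible \<open>P_family i j\<close> meets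
  a centred entry at the top level or just below it.\<close>

lemma P_family_kill:
  assumes x: "x \<in> good_families" and v: "valid_stack v" and comp: "\<not> compatible i j v" and j: "1 \<le> j"
  shows "family_value (x \<bullet> P_family i j \<bullet> stack_family v) = 0"
proof -
  have "v \<noteq> []" using comp j by (auto simp: compatible_def)
  then obtain k b u where v_eq: "v = (k, b) # u" by (metis list.exhaust surj_pair)
  have top: "k \<in> I" "b \<in> carrier (A k)" "\<phi> k b = 0" using v v_eq by auto
  show ?thesis
  proof (cases "k = i")
    case False
    show ?thesis
      by (rule P_family_kill_at[OF x v, of "(k, Suc (length u))" i j b])
        (use False top comp j v_eq in \<open>auto simp: site_iff compatible_def\<close>)
  next
    case True
    \<comment> \<open>With top label i, incompatibility leaves only \<open>length v > j\<close>; the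
      level below the top is therefore still at height at least j, and its label differs from
      i.\<close>
    then have "u \<noteq> []" "j \<le> length u" using comp j v_eq by (auto simp: compatible_def)
    then obtain k' b' u' where u_eq: "u = (k', b') # u'" by (metis list.exhaust surj_pair)
    have "k' \<in> I" "b' \<in> carrier (A k')" "\<phi> k' b' = 0" "k' \<noteq> i" using v v_eq u_eq True by auto
    then show ?thesis
      by (intro P_family_kill_at[OF x v, of "(k', Suc (length u'))" i j b'])
        (use \<open>j \<le> length u\<close> j v_eq u_eq in \<open>auto simp: site_iff\<close>)
  qed
qed

lemma P_family_value:
  assumes "x \<in> good_families" "valid_stack v" "1 \<le> j"
  shows "family_value (x \<bullet> P_family i j \<bullet> stack_family v)
    = (if compatible i j v then family_value (x \<bullet> stack_family v) else 0)"
  using assms P_family_absorb P_family_kill by simp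

definition active :: "'i \<Rightarrow> nat \<Rightarrow> ('i \<times> 'a) list \<Rightarrow> bool" where
  "active i j v \<longleftrightarrow> (length v = j \<and> v \<noteq> [] \<and> fst (hd v) = i)
     \<or> (Suc (length v) = j \<and> (v = [] \<or> fst (hd v) \<noteq> i))"

text \<open>The conditions for j - 1 and j are nested, so
  \<open>P\<^sub>i(j) - P\<^sub>i(j-1)\<close> retains the stacks compatible with j but not with j -
  1. For j = 1 nothing is subtracted.\<close>

lemma active_iff:
  "1 \<le> j \<Longrightarrow> active i j v \<longleftrightarrow> compatible i j v \<and> (j = 1 \<or> \<not> compatible i (j - 1) v)"
  by (cases v) (auto simp: active_def compatible_def)

lemma p_value:
  assumes "x \<in> good_families" "valid_stack v" "1 \<le> j"
  shows "family_value (x \<bullet> P_family i j \<bullet> stack_family v)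
      - (if j = 1 then 0 else family_value (x \<bullet> P_family i (j - 1) \<bullet> stack_family v))
    = (if active i j v then family_value (x \<bullet> stack_family v) else 0)"
proof -
  note P_value = P_family_value[OF assms(1,2)]
  show ?thesis
  proof (cases "j = 1")
    case True
    then show ?thesis unfolding active_iff[OF assms(3)] P_value[OF assms(3)] by simp
  next
    case False
    then have "1 \<le> j - 1" using assms(3) by linarith
    moreover have "compatible i (j - 1) v \<Longrightarrow> compatible i j v"
      using assms(3) by (auto simp: compatible_def)
    ultimately show ?thesis
      unfolding active_iff[OF assms(3)] P_value[OF assms(3)] P_value[OF \<open>1 \<le> j - 1\<close>]
      using False by auto
  qed
qed

section \<open>Replicas on stacks: the new top entry\<close>

text \<open>Centring: a = c + \<phi> a 1. The first summand keeps the stack valid, and the second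
  puts a multiple of the unit on the new level, which amounts to the stack \<open>v\<close>
  itself.\<close>

lemma push_value:
  assumes v: "valid_stack v" and i: "i \<in> I" "a \<in> carrier (A i)"
    and top: "v = [] \<or> fst (hd v) \<noteq> i"
  obtains c where "valid_stack ((i, c) # v)"
    "\<And>x. x \<in> entry_families I A \<Longrightarrow> family_value (x \<bullet> stack_family ((i, a) # v))
      = family_value (x \<bullet> stack_family ((i, c) # v)) + \<phi> i a * family_value (x \<bullet> stack_family v)"
proof -
  let ?s = "(i, Suc (length v))"
  have s: "?s \<in> sites I" using i by (simp add: site_iff)
  interpret nc_probability_space "A i" "\<phi> i" using i(1) by (rule space)
  define c where "c = a \<ominus>\<^bsub>A i\<^esub> \<phi> i a \<odot>\<^bsub>A i\<^esub> \<one>\<^bsub>A i\<^esub>"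
  have c: "c \<in> carrier (A i)" unfolding c_def using i by (intro minus_closed) simp_all
  have "\<phi> i c = 0"
    unfolding c_def using i linear_functional_minus[OF functional_linear, of a "\<phi> i a \<odot>\<^bsub>A i\<^esub> \<one>\<^bsub>A i\<^esub>"]
    by simp
  moreover have a: "a = c \<oplus>\<^bsub>A i\<^esub> \<phi> i a \<odot>\<^bsub>A i\<^esub> \<one>\<^bsub>A i\<^esub>"
    unfolding c_def using i by (simp add: a_minus_def a_assoc l_neg)
  ultimately have "valid_stack ((i, c) # v)" using c i v top by simp
  moreover have "family_value (x \<bullet> stack_family ((i, a) # v))
      = family_value (x \<bullet> stack_family ((i, c) # v)) + \<phi> i a * family_value (x \<bullet> stack_family v)"
    if x: "x \<in> entry_families I A" for x
  proof -
    let ?y = "x \<bullet> stack_family v"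
    have y: "?y \<in> entry_families I A"
      using x stack_family_closed[OF v] entry.m_closed by simp
    have xs: "x ?s \<in> carrier (tilde (A i))" using entry_families_carrier[OF x s] by simp
    have upd: "x \<bullet> stack_family ((i, b) # v) = ?y(?s := x ?s \<otimes>\<^bsub>tilde (A i)\<^esub> tilde_in (A i) b)" for b
      using s by (intro ext) (simp add: entry_monoid_simps)
    \<comment> \<open>The new level lies above the top of \<open>v\<close>, where the stack has the
      unit.\<close>
    have "?y ?s = x ?s"
      using xs stack_family_above[OF s, of v] by (simp add: entry_mult_at[OF s])
    then have ys: "?y(?s := x ?s) = ?y" by (metis fun_upd_triv)
    have "x ?s \<otimes>\<^bsub>tilde (A i)\<^esub> tilde_in (A i) a
        = x ?s \<otimes>\<^bsub>tilde (A i)\<^esub> tilde_in (A i) c \<oplus>\<^bsub>tilde (A i)\<^esub> \<phi> i a \<odot>\<^bsub>tilde (A i)\<^esub> x ?s"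
      by (subst a) (use c xs tilde_in_hom[of c "\<phi> i a \<odot>\<^bsub>A i\<^esub> \<one>\<^bsub>A i\<^esub>"] tilde_in_hom[of "\<one>\<^bsub>A i\<^esub>" "\<one>\<^bsub>A i\<^esub>"]
        in \<open>simp add: tilde.r_distr tilde.smult_mult_right\<close>)
    then have "family_value (x \<bullet> stack_family ((i, a) # v))
      = family_value (?y(?s := x ?s \<otimes>\<^bsub>tilde (A i)\<^esub> tilde_in (A i) c))
        + family_value (?y(?s := \<phi> i a \<odot>\<^bsub>tilde (A i)\<^esub> x ?s))"
      unfolding upd using family_value_upd_add[OF y s] c xs by simp
    also have "family_value (?y(?s := \<phi> i a \<odot>\<^bsub>tilde (A i)\<^esub> x ?s)) = \<phi> i a * family_value ?y"
      using family_value_upd_smult[OF y s] xs ys by simp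
    finally show ?thesis unfolding upd .
  qed
  ultimately show ?thesis by (rule that)
qed

text \<open>The site above the top carries the unit, so the entry of \<open>iota_family\<close>
  simply becomes the new top. In contrast to the projections, this is an equality of families and
  holds for arbitrary \<open>x\<close>.\<close>

lemma iota_times_push:
  assumes x: "x \<in> entry_families I A" and i: "i \<in> I" "a \<in> carrier (A i)"
  shows "x \<bullet> iota_family i (Suc (length v)) a \<bullet> stack_family v = x \<bullet> stack_family ((i, a) # v)"
proof (rule ext)
  interpret nc_probability_space "A i" "\<phi> i" using i(1) by (rule space)
  fix s
  show "(x \<bullet> iota_family i (Suc (length v)) a \<bullet> stack_family v) s = (x \<bullet> stack_family ((i, a) # v)) s"
  proof (cases "s \<in> sites I")
    case s: True
    interpret S: ring "site_algebra s" using s by (rule site_ring)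
    have xs: "x s \<in> carrier (site_algebra s)" using entry_families_carrier[OF x s] .
    show ?thesis
    proof (cases "s = (i, Suc (length v))")
      case True
      then have "stack_family v s = \<one>\<^bsub>site_algebra s\<^esub>" using s by (intro stack_family_above) simp_all
      then show ?thesis
        using True s xs i site_closed(3)[OF s, of a] by (simp add: entry_mult_at iota_family_at)
    next
      case False
      then show ?thesis
        using s xs by (simp add: entry_mult_at[OF s] iota_family_at[OF s])
    qed
  qed (simp add: entry_monoid_simps)
qed

lemma iota_times_top:
  assumes x: "x \<in> entry_families I A" and i: "i \<in> I" "a \<in> carrier (A i)" "b \<in> carrier (A i)"
  shows "x \<bullet> iota_family i (Suc (length u)) a \<bullet> stack_family ((i, b) # u)
    = x \<bullet> stack_family ((i, a \<otimes>\<^bsub>A i\<^esub> b) # u)"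
proof (rule ext)
  interpret nc_probability_space "A i" "\<phi> i" using i(1) by (rule space)
  fix s
  show "(x \<bullet> iota_family i (Suc (length u)) a \<bullet> stack_family ((i, b) # u)) s
    = (x \<bullet> stack_family ((i, a \<otimes>\<^bsub>A i\<^esub> b) # u)) s"
  proof (cases "s \<in> sites I")
    case s: True
    interpret S: ring "site_algebra s" using s by (rule site_ring)
    have xs: "x s \<in> carrier (site_algebra s)" using entry_families_carrier[OF x s] .
    show ?thesis
    proof (cases "s = (i, Suc (length u))")
      case True
      then show ?thesis
        using s xs i by (simp add: entry_mult_at iota_family_at tilde_in_hom tilde.m_assoc)
    next
      case False
      then show ?thesis
        using s xs by (simp add: entry_mult_at[OF s] iota_family_at[OF s])
    qed
  qed (simp add: entry_monoid_simps)
qed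

text \<open>In both active cases one entry, not necessarily centred, arises at level j above a stack
  \<open>u\<close> of length j - 1: the product a b if level j was occupied by b, and a itself
  otherwise. Centring this entry gives the two terms.\<close>

lemma replica_value:
  assumes v: "valid_stack v" and i: "i \<in> I" "a \<in> carrier (A i)" and act: "active i j v"
  obtains c t u where "valid_stack ((i, c) # u)" "Suc (length u) = j"
    "\<And>x. x \<in> entry_families I A \<Longrightarrow> family_value (x \<bullet> iota_family i j a \<bullet> stack_family v)
      = family_value (x \<bullet> stack_family ((i, c) # u)) + t * family_value (x \<bullet> stack_family u)"
proof -
  interpret nc_probability_space "A i" "\<phi> i" using i(1) by (rule space)
  have "\<exists>u d. valid_stack u \<and> (u = [] \<or> fst (hd u) \<noteq> i) \<and> d \<in> carrier (A i) \<and> Suc (length u) = j \<and>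
    (\<forall>x\<in>entry_families I A. x \<bullet> iota_family i j a \<bullet> stack_family v = x \<bullet> stack_family ((i, d) # u))"
  proof (cases "length v = j")
    case True
    then obtain b u where v_eq: "v = (i, b) # u" and j: "j = Suc (length u)"
      using act by (cases v) (auto simp: active_def)
    have b: "b \<in> carrier (A i)" "valid_stack u" "u = [] \<or> fst (hd u) \<noteq> i" using v v_eq by auto
    have "\<forall>x\<in>entry_families I A. x \<bullet> iota_family i j a \<bullet> stack_family v = x \<bullet> stack_family ((i, a \<otimes>\<^bsub>A i\<^esub> b) # u)"
      unfolding v_eq j using iota_times_top[OF _ i b(1)] by blast
    then show ?thesis using b i j by (intro exI[of _ u] exI[of _ "a \<otimes>\<^bsub>A i\<^esub> b"]) simp
  next
    case False
    then have j: "j = Suc (length v)" and top: "v = [] \<or> fst (hd v) \<noteq> i"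
      using act by (auto simp: active_def)
    have "\<forall>x\<in>entry_families I A. x \<bullet> iota_family i j a \<bullet> stack_family v = x \<bullet> stack_family ((i, a) # v)"
      unfolding j using iota_times_push[OF _ i] by blast
    then show ?thesis using v top i j by (intro exI[of _ v] exI[of _ a]) simp
  qed
  then obtain u d where u: "valid_stack u" "u = [] \<or> fst (hd u) \<noteq> i" "d \<in> carrier (A i)" "Suc (length u) = j"
    and eq: "\<And>x. x \<in> entry_families I A \<Longrightarrow>
      x \<bullet> iota_family i j a \<bullet> stack_family v = x \<bullet> stack_family ((i, d) # u)"
    by blast
  show ?thesis
    by (rule push_value[OF u(1) i(1) u(3,2)], rule that[of _ u "\<phi> i d"])
      (assumption, rule u(4), simp only: eq)
qed

section \<open>Replicas acting on stacks\<close>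

abbreviation T where "T \<equiv> tensor_algebra I A"

text \<open>Differences suffice because a replica involves only
  \<open>P\<^sub>i(j) - P\<^sub>i(j-1)\<close>. Linear identities for \<open>pairing\<close> pass
  from simple tensors to this set by induction.\<close>

inductive_set good_span :: "('i, 'a) tensor set" where
  simple: "x \<in> good_families \<Longrightarrow> st x \<in> good_span"
| diff: "\<lbrakk>X \<in> good_span; Y \<in> good_span\<rbrakk> \<Longrightarrow> X \<ominus>\<^bsub>T\<^esub> Y \<in> good_span"

text \<open>Stands in for the action of \<open>X\<close> on the vector \<open>v\<close>, followed by
  the vacuum expectation. The rightmost factor of \<open>X\<close> meets the stack first and can be
  traded for a change of stack.\<close>

definition pairing :: "('i, 'a) tensor \<Rightarrow> ('i \<times> 'a) list \<Rightarrow> complex" where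
  "pairing X v = \<Phi> (X \<otimes>\<^bsub>T\<^esub> st (stack_family v))"

lemma good_span_closed: "X \<in> good_span \<Longrightarrow> X \<in> carrier T"
  by (induction rule: good_span.induct) (auto simp: good_entry)

lemma zero_good_span: "\<zero>\<^bsub>T\<^esub> \<in> good_span"
proof -
  have "st \<one>\<^bsub>entry_monoid I A\<^esub> \<in> good_span" by (intro good_span.simple good_one)
  then have "st \<one>\<^bsub>entry_monoid I A\<^esub> \<ominus>\<^bsub>T\<^esub> st \<one>\<^bsub>entry_monoid I A\<^esub> \<in> good_span"
    by (intro good_span.diff)
  then show ?thesis using good_span_closed[OF \<open>st \<one>\<^bsub>entry_monoid I A\<^esub> \<in> good_span\<close>]
    by (simp add: a_minus_def T.r_neg)
qed

lemma mult_diff: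
  assumes "X \<in> carrier T" "Y \<in> carrier T" "Z \<in> carrier T"
  shows "(X \<ominus>\<^bsub>T\<^esub> Y) \<otimes>\<^bsub>T\<^esub> Z = X \<otimes>\<^bsub>T\<^esub> Z \<ominus>\<^bsub>T\<^esub> Y \<otimes>\<^bsub>T\<^esub> Z"
    and "Z \<otimes>\<^bsub>T\<^esub> (X \<ominus>\<^bsub>T\<^esub> Y) = Z \<otimes>\<^bsub>T\<^esub> X \<ominus>\<^bsub>T\<^esub> Z \<otimes>\<^bsub>T\<^esub> Y"
  using assms by (simp_all add: a_minus_def T.l_distr T.r_distr T.l_minus T.r_minus)

lemma pairing_simple:
  assumes "x \<in> entry_families I A" "valid_stack v"
  shows "pairing (st x) v = family_value (x \<bullet> stack_family v)"
proof -
  have "x \<bullet> stack_family v \<in> entry_families I A"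
    using assms stack_family_closed entry.m_closed by simp
  then show ?thesis
    using assms by (simp add: pairing_def simple_tensor_mult stack_family_closed \<Phi>_simple_tensor)
qed

lemma pairing_diff:
  assumes "X \<in> carrier T" "Y \<in> carrier T" "valid_stack v"
  shows "pairing (X \<ominus>\<^bsub>T\<^esub> Y) v = pairing X v - pairing Y v"
  using assms stack_family_closed
  by (simp add: pairing_def mult_diff T.linear_functional_minus[OF \<Phi>_linear])

lemma replica_eq:
  assumes "1 \<le> j"
  shows "replica I A i j a = st (iota_family i j a) \<otimes>\<^bsub>T\<^esub>
    (st (P_family i j) \<ominus>\<^bsub>T\<^esub> (if j = 1 then \<zero>\<^bsub>T\<^esub> else st (P_family i (j - 1))))"
  using assms
  by (auto simp: replica_def replica_iota_def replica_p_def replica_P_def iota_family_def P_family_def)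

lemma simple_times_replica:
  assumes "x \<in> entry_families I A" "i \<in> I" "a \<in> carrier (A i)" "1 \<le> j"
  shows "st x \<otimes>\<^bsub>T\<^esub> replica I A i j a = st (x \<bullet> iota_family i j a \<bullet> P_family i j)
    \<ominus>\<^bsub>T\<^esub> (if j = 1 then \<zero>\<^bsub>T\<^esub> else st (x \<bullet> iota_family i j a \<bullet> P_family i (j - 1)))"
proof -
  have io: "iota_family i j a \<in> entry_families I A"
    using assms by (intro iota_family_closed) (simp_all add: site_iff)
  then have xi: "x \<bullet> iota_family i j a \<in> entry_families I A"
    using assms entry.m_closed by simp
  have "st x \<otimes>\<^bsub>T\<^esub> replica I A i j a = st (x \<bullet> iota_family i j a) \<otimes>\<^bsub>T\<^esub>
    (st (P_family i j) \<ominus>\<^bsub>T\<^esub> (if j = 1 then \<zero>\<^bsub>T\<^esub> else st (P_family i (j - 1))))"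
    unfolding replica_eq[OF assms(4)] simple_tensor_mult[OF assms(1) io, symmetric]
    using assms(1) io P_family_closed by (subst T.m_assoc) (simp_all add: T.minus_closed)
  also have "\<dots> = st (x \<bullet> iota_family i j a \<bullet> P_family i j)
    \<ominus>\<^bsub>T\<^esub> (if j = 1 then \<zero>\<^bsub>T\<^esub> else st (x \<bullet> iota_family i j a \<bullet> P_family i (j - 1)))"
    using xi P_family_closed T.r_null[OF simple_tensor_closed[OF xi]]
    by (cases "j = 1") (simp_all add: mult_diff simple_tensor_mult)
  finally show ?thesis .
qed

lemma replica_closed:
  assumes "i \<in> I" "a \<in> carrier (A i)" "1 \<le> j"
  shows "replica I A i j a \<in> carrier T"
  unfolding replica_eq[OF assms(3)]
  using assms iota_family_closed P_family_closed by (auto simp: site_iff intro!: T.m_closed T.minus_closed)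

lemma good_span_times_replica:
  assumes "X \<in> good_span" "i \<in> I" "a \<in> carrier (A i)" "1 \<le> j"
  shows "X \<otimes>\<^bsub>T\<^esub> replica I A i j a \<in> good_span"
  using assms(1)
proof induction
  case (simple x)
  have "x \<bullet> iota_family i j a \<in> good_families"
    using simple assms by (intro good_times_iota) (simp_all add: site_iff)
  then show ?case
    using assms simple good_times_P zero_good_span
    by (simp add: simple_times_replica good_entry good_span.intros)
next
  case (diff X Y)
  then show ?case
    using good_span_closed replica_closed[OF assms(2-4)] by (simp add: mult_diff good_span.intros)
qed

text \<open>In \<open>a(j)\<close> the projection stands to the right of the embedded element, hence
  next to the stack. It decides survival first, with \<open>x\<close> times the embedded element as
  the good left factor.\<close>

lemma pairing_simple_times_replica:
  assumes x: "x \<in> good_families" and v: "valid_stack v" and ia: "i \<in> I" "a \<in> carrier (A i)" "1 \<le> j"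
  shows "pairing (st x \<otimes>\<^bsub>T\<^esub> replica I A i j a) v
    = (if active i j v then family_value (x \<bullet> iota_family i j a \<bullet> stack_family v) else 0)"
proof -
  let ?y = "x \<bullet> iota_family i j a"
  have y: "?y \<in> good_families"
    using x ia by (intro good_times_iota) (simp_all add: site_iff)
  have yP: "?y \<bullet> P_family i k \<in> entry_families I A" for k
    using good_entry[OF good_times_P[OF y]] .
  have "pairing \<zero>\<^bsub>T\<^esub> v = 0"
    using pairing_diff[OF T.zero_closed T.zero_closed v] by (simp add: a_minus_def)
  then have "pairing (st x \<otimes>\<^bsub>T\<^esub> replica I A i j a) v = family_value (?y \<bullet> P_family i j \<bullet> stack_family v)
      - (if j = 1 then 0 else family_value (?y \<bullet> P_family i (j - 1) \<bullet> stack_family v))"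
    unfolding simple_times_replica[OF good_entry[OF x] ia] using yP v
    by (simp add: pairing_diff pairing_simple)
  then show ?thesis
    unfolding p_value[OF y v ia(3)] .
qed

text \<open>The data c, t, u of \<open>replica_value\<close> depend on the replica and the stack but
  not on the left factor. The resulting identity is therefore linear in \<open>X\<close> and extends
  to \<open>good_span\<close>; if its left side is nonzero, so is one of the two pairings on the
  right.\<close>

lemma pairing_times_replica:
  assumes v: "valid_stack v" and ia: "i \<in> I" "a \<in> carrier (A i)" "1 \<le> j" and X: "X \<in> good_span"
    and nz: "pairing (X \<otimes>\<^bsub>T\<^esub> replica I A i j a) v \<noteq> 0"
  obtains c u where "active i j v" "valid_stack ((i, c) # u)" "Suc (length u) = j"
    "pairing X ((i, c) # u) \<noteq> 0 \<or> pairing X u \<noteq> 0"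
proof -
  have R: "replica I A i j a \<in> carrier T" using ia by (rule replica_closed)
  have act: "active i j v"
  proof (rule ccontr)
    assume inact: "\<not> active i j v"
    have "pairing (X \<otimes>\<^bsub>T\<^esub> replica I A i j a) v = 0"
      using X
    proof induction
      case (simple x)
      then show ?case using pairing_simple_times_replica[OF simple v ia] inact by simp
    next
      case (diff X Y)
      then show ?case
        using R v good_span_closed by (simp add: mult_diff pairing_diff)
    qed
    then show False using nz by simp
  qed
  obtain c t u where u: "valid_stack ((i, c) # u)" "Suc (length u) = j"
    and val: "\<And>x. x \<in> entry_families I A \<Longrightarrow> family_value (x \<bullet> iota_family i j a \<bullet> stack_family v)
      = family_value (x \<bullet> stack_family ((i, c) # u)) + t * family_value (x \<bullet> stack_family u)"
    by (rule replica_value[OF v ia(1,2) act]) (rule that, assumption+)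
  have "valid_stack u" using u(1) by simp
  have "pairing (X \<otimes>\<^bsub>T\<^esub> replica I A i j a) v = pairing X ((i, c) # u) + t * pairing X u"
    using X
  proof induction
    case (simple x)
    then show ?case
      unfolding pairing_simple_times_replica[OF simple v ia] using act
      by (simp only: if_True val good_entry pairing_simple u(1) \<open>valid_stack u\<close>)
  next
    case (diff X Y)
    then show ?case
      using R v u(1) \<open>valid_stack u\<close> good_span_closed
      by (simp add: mult_diff pairing_diff algebra_simps del: valid_stack.simps)
  qed
  then have "pairing X ((i, c) # u) \<noteq> 0 \<or> pairing X u \<noteq> 0" using nz by auto
  then show ?thesis using that act u by blast
qed

section \<open>Products of replicas\<close>

definition replica_product :: "('i \<times> nat \<times> 'a) list \<Rightarrow> ('i, 'a) tensor" where
  "replica_product ws = foldr (\<otimes>\<^bsub>T\<^esub>) (map (\<lambda>(i, j, a). replica I A i j a) ws) \<one>\<^bsub>T\<^esub>"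

definition replica_words :: "('i \<times> nat \<times> 'a) list set" where
  "replica_words = lists {(i, j, a). i \<in> I \<and> 1 \<le> j \<and> a \<in> carrier (A i)}"

lemma replica_product_closed: "ws \<in> replica_words \<Longrightarrow> replica_product ws \<in> carrier T"
  by (induction ws) (auto simp: replica_product_def replica_words_def replica_closed)

lemma replica_product_snoc:
  assumes "ws \<in> replica_words" "i \<in> I" "a \<in> carrier (A i)" "1 \<le> j"
  shows "replica_product (ws @ [(i, j, a)]) = replica_product ws \<otimes>\<^bsub>T\<^esub> replica I A i j a"
  using assms(1)
proof (induction ws)
  case Nil
  then show ?case using replica_closed[OF assms(2-4)] by (simp add: replica_product_def)
next
  case (Cons w ws)
  obtain k l b where w: "w = (k, l, b)" by (cases w)
  from Cons.prems have "ws \<in> replica_words" "replica I A k l b \<in> carrier T"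
    using w replica_closed by (auto simp: replica_words_def)
  then show ?case
    using Cons.IH replica_product_closed[of ws] replica_closed[OF assms(2-4)] w
    by (simp add: replica_product_def T.m_assoc)
qed

lemma replica_product_good:
  "ws \<in> replica_words \<Longrightarrow> replica_product ws \<in> good_span"
proof (induction ws rule: rev_induct)
  case Nil
  then show ?case
    using good_span.simple[OF good_one] by (simp add: replica_product_def simple_tensor_one)
next
  case (snoc w ws)
  obtain i j a where "w = (i, j, a)" by (cases w)
  then show ?case
    using snoc by (auto simp: replica_words_def replica_product_snoc[unfolded replica_words_def]
        intro: good_span_times_replica)
qed

abbreviation linked :: "'i \<times> nat \<times> 'a \<Rightarrow> 'i \<times> nat \<times> 'a \<Rightarrow> bool" where
  "linked \<equiv> \<lambda>(i, j, a) (i', j', a'). j \<le> Suc j' \<and> j' \<le> Suc j \<and> (i = i' \<longrightarrow> j = j')"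

text \<open>Arbitrary valid stacks are needed because removing the rightmost replica replaces the
  stack. The \<open>active\<close> clause for the last factor is the information that links its
  color and label to those of the factor removed next to it.\<close>

lemma pairing_replica_product:
  assumes "ws \<in> replica_words" "valid_stack v" "pairing (replica_product ws) v \<noteq> 0"
  shows "if ws = [] then v = [] else fst (snd (hd ws)) = 1 \<and> successively linked ws \<and>
    active (fst (last ws)) (fst (snd (last ws))) v"
  using assms
proof (induction ws arbitrary: v rule: rev_induct)
  case Nil
  show ?case
  proof (cases v)
    \<comment> \<open>A nonempty stack has a centred top entry, which gives the empty product of
      replicas pairing 0.\<close>
    case (Cons w u)
    obtain i b where w: "w = (i, b)" by (cases w)
    have v_eq: "v = (i, b) # u" using Cons w by simp
    let ?s = "(i, Suc (length u))"
    have i: "i \<in> I" "b \<in> carrier (A i)" "\<phi> i b = 0" using Nil v_eq by auto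
    interpret nc_probability_space "A i" "\<phi> i" using i(1) by (rule space)
    have fam: "stack_family v \<in> entry_families I A" using Nil(2) by (rule stack_family_closed)
    have "family_value (stack_family v) = 0"
      by (rule family_value_zero[OF fam, of ?s]) (use i v_eq in \<open>simp_all add: site_iff tilde_functional_in\<close>)
    moreover have "pairing (replica_product []) v = family_value (stack_family v)"
      using fam by (simp add: pairing_def replica_product_def \<Phi>_simple_tensor)
    ultimately show ?thesis using Nil by simp
  qed simp
next
  case (snoc w ws)
  obtain i j a where w: "w = (i, j, a)" by (cases w)
  have ws: "ws \<in> replica_words" and ia: "i \<in> I" "a \<in> carrier (A i)" "1 \<le> j"
    using snoc.prems(1) w by (auto simp: replica_words_def)
  have "pairing (replica_product ws \<otimes>\<^bsub>T\<^esub> replica I A i j a) v \<noteq> 0"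
    using snoc.prems(3) w ws ia by (simp add: replica_product_snoc)
  then obtain c u where act: "active i j v" and u: "valid_stack ((i, c) # u)" "Suc (length u) = j"
    and nz: "pairing (replica_product ws) ((i, c) # u) \<noteq> 0 \<or> pairing (replica_product ws) u \<noteq> 0"
    using pairing_times_replica[OF snoc.prems(2) ia replica_product_good[OF ws]] by metis
  \<comment> \<open>A stack that survives to the left of the last replica: it has length j with top
    label i, or length j - 1 with top label other than i or no top at all.\<close>
  obtain y where y: "y = (i, c) # u \<or> y = u" "valid_stack y" "pairing (replica_product ws) y \<noteq> 0"
  proof (cases "pairing (replica_product ws) u = 0")
    case True
    then show ?thesis using that[of "(i, c) # u"] u(1) nz by blast
  next
    case False
    then show ?thesis using u(1) by (intro that[of u]) simp_all
  qed
  note IH = snoc.IH[OF ws y(2,3)]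
  show ?case
  proof (cases "ws = []")
    case True
    \<comment> \<open>No factor remains, so \<open>y\<close> is empty; hence \<open>y = u\<close>
      and j = 1.\<close>
    then have "j = 1" using IH y(1) u(2) by auto
    then show ?thesis using True act w by simp
  next
    case False
    obtain k l b where last: "last ws = (k, l, b)" by (cases "last ws")
    have "active k l y" using IH False last by simp
    \<comment> \<open>Activity for (k, l) gives l = \<open>length y\<close> if k is the top label
      and l = \<open>length y + 1\<close> otherwise. Compared with the two possible shapes of
      \<open>y\<close>, this bounds the color jump by one and excludes a jump when k = i.\<close>
    then have "l \<le> Suc j \<and> j \<le> Suc l \<and> (k = i \<longrightarrow> l = j)"
      using y(1) u by (auto simp: active_def)
    then show ?thesis
      using IH False act w last by (simp add: successively_append_iff)
  qed
qed

text \<open>The empty stack is the unit, so pairing with it is \<Phi>; being active on it forces the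
  last color to be 1.\<close>

lemma \<Phi>_replica_product:
  assumes "ws \<in> replica_words" "ws \<noteq> []" "\<Phi> (replica_product ws) \<noteq> 0"
  shows "fst (snd (hd ws)) = 1" "fst (snd (last ws)) = 1" "successively linked ws"
proof -
  have "pairing (replica_product ws) [] = \<Phi> (replica_product ws)"
    using replica_product_closed[OF assms(1)] by (simp add: pairing_def simple_tensor_one)
  then show "fst (snd (hd ws)) = 1" "fst (snd (last ws)) = 1" "successively linked ws"
    using pairing_replica_product[OF assms(1), of "[]"] assms by (auto simp: active_def)
qed

text \<open>\<open>replica_functional\<close> is a restriction and agrees with \<Phi> only on the
  replica algebra, so membership is required before it can be evaluated.\<close>

lemma replica_product_in_algebra:
  assumes "ws \<in> replica_words"
  shows "replica_product ws \<in> carrier (replica_algebra I A)"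
proof -
  have "replica_product ws \<in> B"
    if B: "subring B T" and gen: "{replica I A i j a | i j a. i \<in> I \<and> 1 \<le> j \<and> a \<in> carrier (A i)} \<subseteq> B" for B
    using assms
  proof (induction ws)
    case Nil
    interpret subring B T by (rule B)
    show ?case by (simp add: replica_product_def)
  next
    case (Cons w ws)
    interpret subring B T by (rule B)
    obtain i j a where w: "w = (i, j, a)" by (cases w)
    then have "replica I A i j a \<in> B" "ws \<in> replica_words"
      using gen Cons.prems by (auto simp: replica_words_def)
    then show ?case using Cons.IH w by (simp add: replica_product_def)
  qed
  then show ?thesis
    by (auto simp: replica_algebra_def generated_subalgebra_def)
qed

lemma foldr_replica_algebra:
  "foldr (\<otimes>\<^bsub>replica_algebra I A\<^esub>) Xs \<one>\<^bsub>replica_algebra I A\<^esub> = foldr (\<otimes>\<^bsub>T\<^esub>) Xs \<one>\<^bsub>T\<^esub>"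
  by (simp add: replica_algebra_def)

end

theorem proposition5p1:
  fixes I :: "'i set"
    and A :: "'i \<Rightarrow> (complex, 'a) module"
    and \<phi> :: "'i \<Rightarrow> 'a \<Rightarrow> complex"
    and n :: nat
    and i :: "nat \<Rightarrow> 'i"
    and a :: "nat \<Rightarrow> 'a"
    and j :: "nat \<Rightarrow> nat"
  assumes "\<And>l. l \<in> I \<Longrightarrow> nc_probability_space (A l) (\<phi> l)"
    and "1 \<le> n"
    and "\<And>k. k \<in> {1..n} \<Longrightarrow> i k \<in> I"
    and "\<And>k. k \<in> {1..n} \<Longrightarrow> a k \<in> carrier (A (i k))"
    and "\<And>k. k \<in> {1..n} \<Longrightarrow> 1 \<le> j k"
  shows
    "(map j [1..<Suc n] \<notin> labeled_motzkin_words n i \<longrightarrow>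
        replica_functional I A \<phi>
          (foldr (\<otimes>\<^bsub>replica_algebra I A\<^esub>)
            (map (\<lambda>k. replica I A (i k) (j k) (a k)) [1..<Suc n]) \<one>\<^bsub>replica_algebra I A\<^esub>) = 0) \<and>
     ((\<forall>k\<in>{1..<n}. i k \<noteq> i (Suc k)) \<and> map j [1..<Suc n] \<notin> motzkin_words n \<longrightarrow>
        replica_functional I A \<phi>
          (foldr (\<otimes>\<^bsub>replica_algebra I A\<^esub>)
            (map (\<lambda>k. replica I A (i k) (j k) (a k)) [1..<Suc n]) \<one>\<^bsub>replica_algebra I A\<^esub>) = 0)"
proof -
  let ?value = "replica_functional I A \<phi> (foldr (\<otimes>\<^bsub>replica_algebra I A\<^esub>)
    (map (\<lambda>k. replica I A (i k) (j k) (a k)) [1..<Suc n]) \<one>\<^bsub>replica_algebra I A\<^esub>)"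
  interpret nc_family I A \<phi> by (rule nc_family.intro) (rule assms(1))
  define ws where "ws = map (\<lambda>k. (i k, j k, a k)) [1..<Suc n]"
  have ws: "ws \<in> replica_words"
    using assms(3-5) by (auto simp: ws_def replica_words_def)
  have len: "length ws = n" "ws \<noteq> []" using assms(2) by (auto simp: ws_def)
  have nth: "ws ! k = (i (Suc k), j (Suc k), a (Suc k))" if "k < n" for k
    using that by (simp add: ws_def del: upt_Suc)
  have "?value = \<Phi> (replica_product ws)"
    using replica_product_in_algebra[OF ws] unfolding foldr_replica_algebra replica_functional_def
    by (simp add: replica_product_def ws_def comp_def del: upt_Suc)
  moreover have "map j [1..<Suc n] \<in> labeled_motzkin_words n i" if nz: "\<Phi> (replica_product ws) \<noteq> 0"
  proof -
    let ?w = "map j [1..<Suc n]"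
    note cond = \<Phi>_replica_product[OF ws len(2) nz]
    have w_nth: "?w ! k = j (Suc k)" if "k < n" for k
      using that by (simp del: upt_Suc)
    have link: "linked (ws ! k) (ws ! Suc k)" if "Suc k < n" for k
      using successively_nth[OF cond(3), of k] that len(1) by simp
    have ends: "hd ?w = 1" "last ?w = 1"
      using cond(1,2) nth[of 0] nth[of "n - 1"] w_nth[of 0] w_nth[of "n - 1"] assms(2) len
      by (simp_all add: hd_conv_nth last_conv_nth del: upt_Suc)
    have step: "\<bar>int (?w ! k) - int (?w ! (k - 1))\<bar> \<in> {0, 1}" if k: "0 < k" "k < n" for k
    proof -
      obtain m where m: "k = Suc m" using k by (cases k) auto
      then have "linked (ws ! m) (ws ! Suc m)" using link k by simp
      then show ?thesis
        using k m nth[of m] nth[of "Suc m"] w_nth[of m] w_nth[of "Suc m"] by auto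
    qed
    have same: "?w ! (k - 1) = ?w ! k" if k: "k \<in> {1..<n}" "i k = i (Suc k)" for k
    proof -
      obtain m where m: "k = Suc m" using k by (cases k) auto
      then have "linked (ws ! m) (ws ! Suc m)" using link k by simp
      then show ?thesis
        using k m nth[of m] nth[of "Suc m"] w_nth[of m] w_nth[of "Suc m"] by auto
    qed
    have pos: "\<forall>l\<in>set ?w. 1 \<le> l" using assms(5) by auto
    have "length ?w = n" "?w \<noteq> []" using assms(2) by auto
    then have "?w \<in> motzkin_words n"
      unfolding motzkin_words_def using ends step pos by blast
    then show ?thesis
      unfolding labeled_motzkin_words_def using same by blast
  qed
  \<comment> \<open>A word outside \<open>motzkin_words n\<close> is outside the smaller set too, so
    the second claim is an instance of the first.\<close>
  moreover have "labeled_motzkin_words n i \<subseteq> motzkin_words n"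
    by (auto simp: labeled_motzkin_words_def)
  ultimately show ?thesis by (metis subsetD)
qed

end
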